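(* Let $d\ge1$. Assume $p(x_1,\dots,x_d,z)\in\mathbb{C}[x_1,\dots,x_d,z]$ has no zeros in $\mathbb{H}^{d+1}$, $p(0)=0$, and $\frac{\partial p}{\partial z}(0)\neq0$. Write, near $0$, $$p(x,z)=u(x,z)\,(z+\phi(x))$$ with $\phi\in\mathbb{C}\{x_1,\dots,x_d\}$, $\phi(0)=0$, and $u\in\mathbb{C}\{x_1,\dots,x_d,z\}$, $u(0,0)\ne0$, and let $\phi=\sum_{j\ge1}\phi_j$ be the expansion of $\phi$ into homogeneous polynomials $\phi_j$ of degree $j$. Suppose $\phi\notin\mathbb{R}\{x_1,\dots,x_d\}$, and let $\phi_{2L}$ be the first homogeneous term with non-trivial imaginary part (this first term is necessarily of even degree $2L$, $L\ge 1$). If $\operatorname{Im}\phi_{2L}$ is positive definite, then the ideal of admissible numerators for $p$ is $$\mathcal{I}^\infty_p=\big(z+q(x),\,(x)^{2L}\big),$$ where $q(x)=\sum_{j<2L}\phi_j(x)$ and $(x)^{2L}$ is the ideal generated by the monomials $x^\alpha=x_1^{\alpha_1}\cdots x_d^{\alpha_d}$ with $|\alpha|=2L$.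
   Context: $\mathbb{H}=\{z\in\mathbb{C}:\operatorname{Im}z>0\}$, and $\mathbb{D}_\epsilon=\{z\in\mathbb{C}:|z|<\epsilon\}$. $\mathbb{C}\{\cdot\}$, $\mathbb{R}\{\cdot\}$ denote rings of power series in the given variables, with complex resp. real coefficients, convergent in a neighborhood of $0$. The factorization $p=u\cdot(z+\phi)$ exists, with $\phi$ uniquely determined, by the Weierstrass preparation theorem (implicit function theorem). For a power series $f$, $\operatorname{Im}f$ denotes the series obtained by taking imaginary parts of the coefficients, $(\operatorname{Im} f)(x)=\frac{1}{2i}(f(x)-\overline{f(\bar x)})$. "$\operatorname{Im}\phi_{2L}$ is positive definite" means that $\operatorname{Im}\phi_{2L}$ is strictly positive on $\{x\in\mathbb{R}^d:|x|=1\}$. The ideal of admissible numerators is $$\mathcal{I}^\infty_p=\{q(x,z)\in\mathbb{C}\{x_1,\dots,x_d,z\}: q/p \text{ is bounded on } \mathbb{H}^{d+1}\cap\mathbb{D}_\epsilon^{d+1}\text{ for some }\epsilon>0\}.$$ Ideals are ideals of $\mathbb{C}\{x_1,\dots,x_d,z\}$; $(z+q(x),(x)^{2L})$ is the ideal generated by $z+q(x)$ and all the listed monomials. *)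

theory Defs
  imports "HOL-Analysis.Analysis" "HOL-Library.Poly_Mapping"
begin

section \<open>Monomials in finitely many variables\<close>

text \<open>
  Variables are indexed by a finite type \<^typ>\<open>'v\<close>, multi-indices are elements of
  \<^typ>\<open>'v \<Rightarrow>\<^sub>0 nat\<close>, and polynomials are elements of \<^typ>\<open>('v \<Rightarrow>\<^sub>0 nat) \<Rightarrow>\<^sub>0 'a\<close>.
  The variables \<open>x\<^sub>1, \<dots>, x\<^sub>d\<close> are indexed by \<^typ>\<open>'n::finite\<close> (so \<open>d = CARD('n) \<ge> 1\<close>), and the
  variables \<open>x\<^sub>1, \<dots>, x\<^sub>d, z\<close> by \<^typ>\<open>'n option\<close>, where \<^term>\<open>None\<close> stands for \<open>z\<close>.
\<close>

definition mdeg :: "('v::finite \<Rightarrow>\<^sub>0 nat) \<Rightarrow> nat" where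
  "mdeg \<alpha> = (\<Sum>i\<in>UNIV. Poly_Mapping.lookup \<alpha> i)"

definition monom_eval :: "('v::finite \<Rightarrow>\<^sub>0 nat) \<Rightarrow> 'a::comm_monoid_mult ^ 'v \<Rightarrow> 'a" where
  "monom_eval \<alpha> w = (\<Prod>i\<in>UNIV. (w $ i) ^ Poly_Mapping.lookup \<alpha> i)"

definition mpoly_eval :: "(('v::finite \<Rightarrow>\<^sub>0 nat) \<Rightarrow>\<^sub>0 'a::comm_semiring_1) \<Rightarrow> 'a ^ 'v \<Rightarrow> 'a" where
  "mpoly_eval p w = (\<Sum>\<alpha>\<in>Poly_Mapping.keys p. Poly_Mapping.lookup p \<alpha> * monom_eval \<alpha> w)"

definition polydisc :: "real \<Rightarrow> ('a::real_normed_vector ^ 'v::finite) set" where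
  "polydisc \<epsilon> = {w. \<forall>i. norm (w $ i) < \<epsilon>}"

definition poly_halfplane :: "(complex ^ 'v::finite) set" where
  "poly_halfplane = {w. \<forall>i. Im (w $ i) > 0}"

lemma mdeg_add: "mdeg (\<alpha> + \<beta>) = mdeg \<alpha> + mdeg \<beta>"
  by (simp add: mdeg_def lookup_add sum.distrib)

lemma norm_monom_eval_le:
  fixes w :: "'a::real_normed_field ^ 'v::finite"
  assumes "\<And>i. norm (w $ i) \<le> r"
  shows "norm (monom_eval \<alpha> w) \<le> r ^ mdeg \<alpha>"
proof -
  have "norm (monom_eval \<alpha> w) = (\<Prod>i\<in>UNIV. norm (w $ i) ^ Poly_Mapping.lookup \<alpha> i)"
    by (simp add: monom_eval_def prod_norm [symmetric] norm_power)
  also have "\<dots> \<le> (\<Prod>i\<in>UNIV. r ^ Poly_Mapping.lookup \<alpha> i)"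
    by (intro prod_mono) (auto intro: power_mono assms)
  finally show ?thesis by (simp add: mdeg_def power_sum)
qed

lemma monom_eval_const:
  "monom_eval \<alpha> (\<chi> i. c) = (c::'a::real_normed_field) ^ mdeg \<alpha>"
  by (simp add: monom_eval_def mdeg_def power_sum)

lemma finite_add_decomp: "finite {(\<beta>, \<gamma>). \<beta> + \<gamma> = (\<alpha> :: 'v::finite \<Rightarrow>\<^sub>0 nat)}"
proof -
  let ?F = "PiE UNIV (\<lambda>i. {..Poly_Mapping.lookup \<alpha> i})"
  have "finite (?F \<times> ?F)" by (intro finite_cartesian_product finite_PiE) auto
  moreover have "(\<lambda>(\<beta>, \<gamma>). (Poly_Mapping.lookup \<beta>, Poly_Mapping.lookup \<gamma>)) `
      {(\<beta>, \<gamma>). \<beta> + \<gamma> = \<alpha>} \<subseteq> ?F \<times> ?F"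
    by (auto simp: PiE_UNIV_domain lookup_add)
  moreover have "inj_on (\<lambda>(\<beta>, \<gamma>). (Poly_Mapping.lookup \<beta>, Poly_Mapping.lookup \<gamma>))
      {(\<beta>, \<gamma>). \<beta> + \<gamma> = \<alpha>}"
    by (auto simp: inj_on_def intro: poly_mapping_eqI)
  ultimately show ?thesis by (meson finite_subset finite_image_iff)
qed


section \<open>Convergent power series\<close>

definition convergent_coeffs ::
    "(('v::finite \<Rightarrow>\<^sub>0 nat) \<Rightarrow> 'a::{real_normed_field, banach}) \<Rightarrow> bool" where
  "convergent_coeffs c \<longleftrightarrow>
    (\<exists>r>0. \<forall>w \<in> polydisc r. (\<lambda>\<alpha>. c \<alpha> * monom_eval \<alpha> w) abs_summable_on UNIV)"

lemma convergent_coeffs_iff: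
  fixes c :: "('v::finite \<Rightarrow>\<^sub>0 nat) \<Rightarrow> 'a::{real_normed_field, banach}"
  shows "convergent_coeffs c \<longleftrightarrow> (\<exists>r>0. (\<lambda>\<alpha>. norm (c \<alpha>) * r ^ mdeg \<alpha>) summable_on UNIV)"
proof
  assume "convergent_coeffs c"
  then obtain r where r: "r > 0"
    "\<And>w. w \<in> polydisc r \<Longrightarrow> (\<lambda>\<alpha>. c \<alpha> * monom_eval \<alpha> w) abs_summable_on UNIV"
    unfolding convergent_coeffs_def by blast
  have "(\<chi> i. of_real (r / 2)) \<in> (polydisc r :: ('a ^ 'v) set)"
    using r(1) by (auto simp: polydisc_def simp flip: of_real_divide)
  from r(2)[OF this] have "(\<lambda>\<alpha>. norm (c \<alpha>) * (r / 2) ^ mdeg \<alpha>) summable_on UNIV"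
    using r(1) by (simp only: monom_eval_const norm_mult norm_power norm_of_real) simp
  then show "\<exists>r>0. (\<lambda>\<alpha>. norm (c \<alpha>) * r ^ mdeg \<alpha>) summable_on UNIV"
    using r(1) half_gt_zero by blast
next
  assume "\<exists>r>0. (\<lambda>\<alpha>. norm (c \<alpha>) * r ^ mdeg \<alpha>) summable_on UNIV"
  then obtain r where r: "r > 0" "(\<lambda>\<alpha>. norm (c \<alpha>) * r ^ mdeg \<alpha>) summable_on UNIV" by blast
  have "(\<lambda>\<alpha>. c \<alpha> * monom_eval \<alpha> w) abs_summable_on UNIV" if "w \<in> polydisc r" for w
  proof (rule Infinite_Sum.abs_summable_on_comparison_test'[OF r(2)])
    fix \<alpha>
    have "norm (monom_eval \<alpha> w) \<le> r ^ mdeg \<alpha>"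
      using that by (intro norm_monom_eval_le) (auto simp: polydisc_def intro: less_imp_le)
    then show "norm (c \<alpha> * monom_eval \<alpha> w) \<le> norm (c \<alpha>) * r ^ mdeg \<alpha>"
      by (simp add: norm_mult mult_left_mono)
  qed
  then show "convergent_coeffs c" unfolding convergent_coeffs_def using r(1) by blast
qed

lemma convergent_coeffs_mono:
  fixes c :: "('v::finite \<Rightarrow>\<^sub>0 nat) \<Rightarrow> 'a::{real_normed_field, banach}"
    and c' :: "('v::finite \<Rightarrow>\<^sub>0 nat) \<Rightarrow> 'b::{real_normed_field, banach}"
  assumes "convergent_coeffs c" "\<And>\<alpha>. norm (c' \<alpha>) \<le> norm (c \<alpha>)"
  shows "convergent_coeffs c'"
proof -
  obtain r where r: "r > 0" "(\<lambda>\<alpha>. norm (c \<alpha>) * r ^ mdeg \<alpha>) summable_on UNIV"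
    using assms(1) convergent_coeffs_iff by blast
  have "(\<lambda>\<alpha>. norm (c' \<alpha>) * r ^ mdeg \<alpha>) summable_on UNIV"
    by (rule summable_on_comparison_test[OF r(2)])
      (use r(1) assms(2) in \<open>auto intro!: mult_right_mono\<close>)
  then show ?thesis using r(1) convergent_coeffs_iff by blast
qed

lemma convergent_coeffs_finite:
  fixes c :: "('v::finite \<Rightarrow>\<^sub>0 nat) \<Rightarrow> 'a::{real_normed_field, banach}"
  assumes "finite {\<alpha>. c \<alpha> \<noteq> 0}"
  shows "convergent_coeffs c"
proof -
  have "(\<lambda>\<alpha>. norm (c \<alpha>) * 1 ^ mdeg \<alpha>) summable_on {\<alpha>. c \<alpha> \<noteq> 0}"
    using assms by simp
  then have "(\<lambda>\<alpha>. norm (c \<alpha>) * 1 ^ mdeg \<alpha>) summable_on UNIV"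
    by (rule summable_on_cong_neutral[THEN iffD1, rotated -1]) auto
  then show ?thesis unfolding convergent_coeffs_iff using zero_less_one by blast
qed

lemma convergent_coeffs_common:
  fixes c :: "('v::finite \<Rightarrow>\<^sub>0 nat) \<Rightarrow> 'a::{real_normed_field, banach}"
    and c' :: "('v::finite \<Rightarrow>\<^sub>0 nat) \<Rightarrow> 'b::{real_normed_field, banach}"
  assumes "convergent_coeffs c" "convergent_coeffs c'"
  obtains r where "r > 0" "(\<lambda>\<alpha>. norm (c \<alpha>) * r ^ mdeg \<alpha>) summable_on UNIV"
    "(\<lambda>\<alpha>. norm (c' \<alpha>) * r ^ mdeg \<alpha>) summable_on UNIV"
proof -
  obtain r1 where r1: "r1 > 0" "(\<lambda>\<alpha>. norm (c \<alpha>) * r1 ^ mdeg \<alpha>) summable_on UNIV"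
    using assms(1) convergent_coeffs_iff by blast
  obtain r2 where r2: "r2 > 0" "(\<lambda>\<alpha>. norm (c' \<alpha>) * r2 ^ mdeg \<alpha>) summable_on UNIV"
    using assms(2) convergent_coeffs_iff by blast
  show ?thesis
  proof
    show "min r1 r2 > 0" using r1 r2 by simp
    show "(\<lambda>\<alpha>. norm (c \<alpha>) * min r1 r2 ^ mdeg \<alpha>) summable_on UNIV"
      by (rule summable_on_comparison_test[OF r1(2)])
        (use r1(1) r2(1) in \<open>auto intro!: mult_left_mono power_mono\<close>)
    show "(\<lambda>\<alpha>. norm (c' \<alpha>) * min r1 r2 ^ mdeg \<alpha>) summable_on UNIV"
      by (rule summable_on_comparison_test[OF r2(2)])
        (use r1(1) r2(1) in \<open>auto intro!: mult_left_mono power_mono\<close>)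
  qed
qed

lemma convergent_coeffs_add:
  fixes c c' :: "('v::finite \<Rightarrow>\<^sub>0 nat) \<Rightarrow> 'a::{real_normed_field, banach}"
  assumes "convergent_coeffs c" "convergent_coeffs c'"
  shows "convergent_coeffs (\<lambda>\<alpha>. c \<alpha> + c' \<alpha>)"
proof -
  obtain r where r: "r > 0" "(\<lambda>\<alpha>. norm (c \<alpha>) * r ^ mdeg \<alpha>) summable_on UNIV"
    "(\<lambda>\<alpha>. norm (c' \<alpha>) * r ^ mdeg \<alpha>) summable_on UNIV"
    using convergent_coeffs_common[OF assms] .
  have "(\<lambda>\<alpha>. norm (c \<alpha> + c' \<alpha>) * r ^ mdeg \<alpha>) summable_on UNIV"
  proof (rule summable_on_comparison_test[OF summable_on_add[OF r(2,3)]])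
    fix \<alpha>
    show "norm (c \<alpha> + c' \<alpha>) * r ^ mdeg \<alpha> \<le> norm (c \<alpha>) * r ^ mdeg \<alpha> + norm (c' \<alpha>) * r ^ mdeg \<alpha>"
      unfolding distrib_right[symmetric]
      by (intro mult_right_mono norm_triangle_ineq) (use r(1) in simp)
  qed (use r(1) in simp)
  then show ?thesis unfolding convergent_coeffs_iff using r(1) by blast
qed

lemma convergent_coeffs_mult:
  fixes c c' :: "('v::finite \<Rightarrow>\<^sub>0 nat) \<Rightarrow> 'a::{real_normed_field, banach}"
  assumes "convergent_coeffs c" "convergent_coeffs c'"
  shows "convergent_coeffs (\<lambda>\<alpha>. \<Sum>(\<beta>, \<gamma>) | \<beta> + \<gamma> = \<alpha>. c \<beta> * c' \<gamma>)"
proof -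
  obtain r where r: "r > 0" "(\<lambda>\<alpha>. norm (c \<alpha>) * r ^ mdeg \<alpha>) summable_on UNIV"
    "(\<lambda>\<alpha>. norm (c' \<alpha>) * r ^ mdeg \<alpha>) summable_on UNIV"
    using convergent_coeffs_common[OF assms] .
  define A where "A = (\<lambda>\<alpha>. norm (c \<alpha>) * r ^ mdeg \<alpha>)"
  define B where "B = (\<lambda>\<alpha>. norm (c' \<alpha>) * r ^ mdeg \<alpha>)"
  have pos: "A \<alpha> \<ge> 0" "B \<alpha> \<ge> 0" for \<alpha> using r(1) by (auto simp: A_def B_def)
  let ?D = "\<lambda>\<alpha>. {(\<beta>, \<gamma>). \<beta> + \<gamma> = (\<alpha> :: 'v \<Rightarrow>\<^sub>0 nat)}"
  let ?f = "\<lambda>\<alpha>. norm (\<Sum>(\<beta>, \<gamma>)\<in>?D \<alpha>. c \<beta> * c' \<gamma>) * r ^ mdeg \<alpha>"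
  have le: "?f \<alpha> \<le> (\<Sum>(\<beta>, \<gamma>)\<in>?D \<alpha>. A \<beta> * B \<gamma>)" for \<alpha>
  proof -
    have "?f \<alpha> \<le> (\<Sum>x\<in>?D \<alpha>. norm (case x of (\<beta>, \<gamma>) \<Rightarrow> c \<beta> * c' \<gamma>)) * r ^ mdeg \<alpha>"
      by (intro mult_right_mono norm_sum) (use r(1) in simp)
    also have "\<dots> = (\<Sum>(\<beta>, \<gamma>)\<in>?D \<alpha>. A \<beta> * B \<gamma>)"
      unfolding sum_distrib_right
      by (intro sum.cong) (auto simp: A_def B_def norm_mult mdeg_add power_add)
    finally show ?thesis .
  qed
  have "sum ?f F \<le> infsum A UNIV * infsum B UNIV" if F: "finite F" for F
  proof -
    let ?G = "\<Union>\<alpha>\<in>F. ?D \<alpha>"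
    have finG: "finite ?G" using F finite_add_decomp by blast
    have "sum ?f F \<le> (\<Sum>\<alpha>\<in>F. \<Sum>(\<beta>, \<gamma>)\<in>?D \<alpha>. A \<beta> * B \<gamma>)"
      by (intro sum_mono le)
    also have "\<dots> = (\<Sum>(\<beta>, \<gamma>)\<in>?G. A \<beta> * B \<gamma>)"
      by (subst sum.UNION_disjoint) (use F finite_add_decomp in auto)
    also have "\<dots> \<le> (\<Sum>(\<beta>, \<gamma>)\<in>fst ` ?G \<times> snd ` ?G. A \<beta> * B \<gamma>)"
      by (intro sum_mono2 finite_cartesian_product finite_imageI finG)
        (use pos in \<open>force+\<close>)
    also have "\<dots> = sum A (fst ` ?G) * sum B (snd ` ?G)"
      by (simp add: sum_product sum.cartesian_product)
    also have "\<dots> \<le> infsum A UNIV * infsum B UNIV"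
      by (intro mult_mono finite_sum_le_infsum finite_imageI finG sum_nonneg infsum_nonneg)
        (use r pos in \<open>auto simp: A_def B_def\<close>)
    finally show ?thesis .
  qed
  then have "bdd_above (sum ?f ` {F. F \<subseteq> UNIV \<and> finite F})"
    unfolding bdd_above_def by blast
  then have "?f summable_on UNIV"
    using r(1) by (intro nonneg_bdd_above_summable_on) auto
  then show ?thesis unfolding convergent_coeffs_iff using r(1) by blast
qed

text \<open>\<open>('v, complex) cps\<close> and \<open>('v, real) cps\<close> are the rings of power series in the variables
  \<^typ>\<open>'v\<close> that converge in a neighbourhood of \<open>0\<close>.\<close>

typedef (overloaded) ('v, 'a) cps =
    "{c :: ('v::finite \<Rightarrow>\<^sub>0 nat) \<Rightarrow> 'a::{real_normed_field, banach}. convergent_coeffs c}"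
  morphisms cps_coeff Abs_cps
  by (rule exI[of _ "\<lambda>_. 0"]) (simp add: convergent_coeffs_finite)

setup_lifting type_definition_cps

lemma cps_eqI: "(\<And>\<alpha>. cps_coeff f \<alpha> = cps_coeff g \<alpha>) \<Longrightarrow> f = g"
  by (metis ext cps_coeff_inject)

instantiation cps :: (finite, "{real_normed_field, banach}") comm_ring_1
begin

lift_definition zero_cps :: "('a, 'b) cps" is "\<lambda>_. 0"
  by (simp add: convergent_coeffs_finite)

lift_definition one_cps :: "('a, 'b) cps" is "\<lambda>\<alpha>. if \<alpha> = 0 then 1 else 0"
  by (rule convergent_coeffs_finite) simp

lift_definition plus_cps :: "('a, 'b) cps \<Rightarrow> ('a, 'b) cps \<Rightarrow> ('a, 'b) cps"
  is "\<lambda>f g \<alpha>. f \<alpha> + g \<alpha>"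
  by (rule convergent_coeffs_add)

lift_definition uminus_cps :: "('a, 'b) cps \<Rightarrow> ('a, 'b) cps" is "\<lambda>f \<alpha>. - f \<alpha>"
  by (erule convergent_coeffs_mono) simp

definition minus_cps :: "('a, 'b) cps \<Rightarrow> ('a, 'b) cps \<Rightarrow> ('a, 'b) cps" where
  "minus_cps f g = f + (- g)"

lift_definition times_cps :: "('a, 'b) cps \<Rightarrow> ('a, 'b) cps \<Rightarrow> ('a, 'b) cps"
  is "\<lambda>f g \<alpha>. \<Sum>(\<beta>, \<gamma>) | \<beta> + \<gamma> = \<alpha>. f \<beta> * g \<gamma>"
  by (rule convergent_coeffs_mult)

instance
proof
  fix a b c :: "('a, 'b) cps"
  show "a + b + c = a + (b + c)" "a + b = b + a" "0 + a = a" "- a + a = 0" "a - b = a + - b"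
    by (simp_all add: minus_cps_def) (transfer; simp add: algebra_simps)+
  show "(0 :: ('a, 'b) cps) \<noteq> 1"
    by transfer (metis zero_neq_one)
  show "(a + b) * c = a * c + b * c"
    by transfer (simp add: distrib_right sum.distrib case_prod_unfold)
  show "a * b = b * a"
    by transfer
      (rule ext, rule sum.reindex_bij_witness[of _ prod.swap prod.swap],
        auto simp: mult.commute add.commute)
  show "1 * a = a"
  proof (transfer, rule ext)
    fix a :: "('a \<Rightarrow>\<^sub>0 nat) \<Rightarrow> 'b" and \<alpha>
    have "(\<Sum>(\<beta>, \<gamma>) | \<beta> + \<gamma> = \<alpha>. (if \<beta> = 0 then 1 else 0) * a \<gamma>)
        = (\<Sum>(\<beta>, \<gamma>)\<in>{(0 :: 'a \<Rightarrow>\<^sub>0 nat, \<alpha>)}. (if \<beta> = 0 then 1 else 0) * a \<gamma>)"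
      by (rule sum.mono_neutral_right) (auto simp: finite_add_decomp split: if_splits)
    then show "(\<Sum>(\<beta>, \<gamma>) | \<beta> + \<gamma> = \<alpha>. (if \<beta> = 0 then 1 else 0) * a \<gamma>) = a \<alpha>" by simp
  qed
  show "a * b * c = a * (b * c)"
  proof (transfer, rule ext)
    fix a b c :: "('a \<Rightarrow>\<^sub>0 nat) \<Rightarrow> 'b" and \<alpha>
    let ?D = "\<lambda>\<alpha>. {(\<beta>, \<gamma>). \<beta> + \<gamma> = (\<alpha> :: 'a \<Rightarrow>\<^sub>0 nat)}"
    have "(\<Sum>(\<beta>, \<gamma>)\<in>?D \<alpha>. (\<Sum>(\<delta>, \<epsilon>)\<in>?D \<beta>. a \<delta> * b \<epsilon>) * c \<gamma>)
        = (\<Sum>x\<in>?D \<alpha>. \<Sum>y\<in>?D (fst x). a (fst y) * b (snd y) * c (snd x))"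
      by (simp add: sum_distrib_right case_prod_unfold)
    also have "\<dots> = (\<Sum>(x, y)\<in>Sigma (?D \<alpha>) (\<lambda>x. ?D (fst x)). a (fst y) * b (snd y) * c (snd x))"
      by (rule sum.Sigma) (auto simp: finite_add_decomp)
    also have "\<dots> = (\<Sum>(x, y)\<in>Sigma (?D \<alpha>) (\<lambda>x. ?D (snd x)). a (fst x) * (b (fst y) * c (snd y)))"
      by (rule sum.reindex_bij_witness[of _
            "\<lambda>((\<beta>, \<gamma>), (\<delta>, \<epsilon>)). ((\<beta> + \<delta>, \<epsilon>), (\<beta>, \<delta>))"
            "\<lambda>((\<beta>, \<gamma>), (\<delta>, \<epsilon>)). ((\<delta>, \<epsilon> + \<gamma>), (\<epsilon>, \<gamma>))"])
        (auto simp: algebra_simps)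
    also have "\<dots> = (\<Sum>x\<in>?D \<alpha>. \<Sum>y\<in>?D (snd x). a (fst x) * (b (fst y) * c (snd y)))"
      by (rule sum.Sigma[symmetric]) (auto simp: finite_add_decomp)
    also have "\<dots> = (\<Sum>(\<beta>, \<gamma>)\<in>?D \<alpha>. a \<beta> * (\<Sum>(\<delta>, \<epsilon>)\<in>?D \<gamma>. b \<delta> * c \<epsilon>))"
      by (simp add: sum_distrib_left case_prod_unfold)
    finally show "(\<Sum>(\<beta>, \<gamma>)\<in>?D \<alpha>. (\<Sum>(\<delta>, \<epsilon>)\<in>?D \<beta>. a \<delta> * b \<epsilon>) * c \<gamma>)
        = (\<Sum>(\<beta>, \<gamma>)\<in>?D \<alpha>. a \<beta> * (\<Sum>(\<delta>, \<epsilon>)\<in>?D \<gamma>. b \<delta> * c \<epsilon>))" .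
  qed
qed

end

text \<open>The value at a point is meaningful where the series converges absolutely, hence
  on some polydisc around \<open>0\<close>.\<close>

definition cps_eval ::
    "('v::finite, 'a::{real_normed_field, banach}) cps \<Rightarrow> 'a ^ 'v \<Rightarrow> 'a" where
  "cps_eval f w = (\<Sum>\<^sub>\<infinity>\<alpha>. cps_coeff f \<alpha> * monom_eval \<alpha> w)"

definition cps_of_mpoly ::
    "(('v::finite \<Rightarrow>\<^sub>0 nat) \<Rightarrow>\<^sub>0 'a::{real_normed_field, banach}) \<Rightarrow> ('v, 'a) cps" where
  "cps_of_mpoly p = Abs_cps (Poly_Mapping.lookup p)"

lemma cps_coeff_of_mpoly: "cps_coeff (cps_of_mpoly p) = Poly_Mapping.lookup p"
  by (simp add: cps_of_mpoly_def Abs_cps_inverse convergent_coeffs_finite)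

definition cps_monom :: "('v::finite \<Rightarrow>\<^sub>0 nat) \<Rightarrow> ('v, 'a::{real_normed_field, banach}) cps" where
  "cps_monom \<alpha> = cps_of_mpoly (Poly_Mapping.single \<alpha> 1)"

definition cps_var :: "'v::finite \<Rightarrow> ('v, 'a::{real_normed_field, banach}) cps" where
  "cps_var i = cps_monom (Poly_Mapping.single i 1)"

lift_definition cps_hom_part ::
    "nat \<Rightarrow> ('v::finite, 'a::{real_normed_field, banach}) cps \<Rightarrow> ('v, 'a) cps"
  is "\<lambda>j f \<alpha>. if mdeg \<alpha> = j then f \<alpha> else 0"
  by (erule convergent_coeffs_mono) simp

lift_definition cps_of_real :: "('v::finite, real) cps \<Rightarrow> ('v, complex) cps"
  is "\<lambda>f \<alpha>. complex_of_real (f \<alpha>)"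
  by (erule convergent_coeffs_mono) simp

lift_definition cps_Im :: "('v::finite, complex) cps \<Rightarrow> ('v, real) cps"
  is "\<lambda>f \<alpha>. Im (f \<alpha>)"
  by (erule convergent_coeffs_mono) (simp add: abs_Im_le_cmod)

text \<open>The inclusion of the series in \<open>x\<^sub>1, \<dots>, x\<^sub>d\<close> into the series in \<open>x\<^sub>1, \<dots>, x\<^sub>d, z\<close>;
  \<^term>\<open>Poly_Mapping.map_key Some \<beta>\<close> is the multi-index of the \<open>x\<close>-variables in \<open>\<beta>\<close>.\<close>

lift_definition cps_incl ::
    "('n::finite, 'a::{real_normed_field, banach}) cps \<Rightarrow> ('n option, 'a) cps"
  is "\<lambda>f \<beta>. if Poly_Mapping.lookup \<beta> None = 0 then f (Poly_Mapping.map_key Some \<beta>) else 0"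
proof -
  fix f :: "('n \<Rightarrow>\<^sub>0 nat) \<Rightarrow> 'a"
  assume "convergent_coeffs f"
  then obtain r where r: "r > 0" "(\<lambda>\<alpha>. norm (f \<alpha>) * r ^ mdeg \<alpha>) summable_on UNIV"
    using convergent_coeffs_iff by blast
  let ?S = "{\<beta> :: 'n option \<Rightarrow>\<^sub>0 nat. Poly_Mapping.lookup \<beta> None = 0}"
  let ?k = "Poly_Mapping.map_key (Some :: 'n \<Rightarrow> 'n option) :: _ \<Rightarrow> 'n \<Rightarrow>\<^sub>0 nat"
  let ?g = "\<lambda>\<beta>. if Poly_Mapping.lookup \<beta> None = 0 then f (?k \<beta>) else 0"
  have lk: "Poly_Mapping.lookup (?k \<beta>) i = Poly_Mapping.lookup \<beta> (Some i)" for \<beta> i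
    by (simp add: map_key.rep_eq)
  have inj: "inj_on ?k ?S"
  proof (rule inj_onI, rule poly_mapping_eqI)
    fix \<beta> \<gamma> i assume *: "\<beta> \<in> ?S" "\<gamma> \<in> ?S" "?k \<beta> = ?k \<gamma>"
    then show "Poly_Mapping.lookup \<beta> i = Poly_Mapping.lookup \<gamma> i"
      by (cases i) (auto simp flip: lk)
  qed
  have deg: "mdeg (?k \<beta>) = mdeg \<beta>" if "\<beta> \<in> ?S" for \<beta>
    using that by (simp add: mdeg_def lk UNIV_option_conv sum.reindex)
  have "(\<lambda>\<alpha>. norm (f \<alpha>) * r ^ mdeg \<alpha>) summable_on (?k ` ?S)"
    using r(2) by (rule summable_on_subset_banach) simp
  then have "(\<lambda>\<beta>. norm (f (?k \<beta>)) * r ^ mdeg (?k \<beta>)) summable_on ?S"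
    by (simp add: summable_on_reindex[OF inj] o_def)
  then have "(\<lambda>\<beta>. norm (?g \<beta>) * r ^ mdeg \<beta>) summable_on UNIV"
    by (rule summable_on_cong_neutral[THEN iffD1, rotated -1]) (auto simp: deg)
  then show "convergent_coeffs ?g" unfolding convergent_coeffs_iff using r(1) by blast
qed


section \<open>Ideals and admissible numerators\<close>

text \<open>The ideal generated by a set is its span in the ring regarded as a module over itself.\<close>

lemma module_self: "module ((*) :: 'r::comm_ring_1 \<Rightarrow> 'r \<Rightarrow> 'r)"
  by standard (simp_all add: algebra_simps)

definition ideal_generated_by :: "'r::comm_ring_1 set \<Rightarrow> 'r set" where
  "ideal_generated_by S = module.span (*) S"

text \<open>Boundedness for some \<open>\<epsilon>\<close> implies boundedness for every smaller \<open>\<epsilon>\<close>, so the default values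
  of \<^const>\<open>cps_eval\<close> outside the domain of convergence play no role here.\<close>

definition admissible_numerators ::
    "(('v::finite \<Rightarrow>\<^sub>0 nat) \<Rightarrow>\<^sub>0 complex) \<Rightarrow> ('v, complex) cps set" where
  "admissible_numerators p =
    {q. \<exists>\<epsilon>>0. bounded ((\<lambda>w. cps_eval q w / mpoly_eval p w) ` (poly_halfplane \<inter> polydisc \<epsilon>))}"

definition pos_definite :: "('n::finite, real) cps \<Rightarrow> bool" where
  "pos_definite f \<longleftrightarrow> (\<forall>x :: real ^ 'n. norm x = 1 \<longrightarrow> cps_eval f x > 0)"

definition with_z :: "'a ^ 'n \<Rightarrow> 'a \<Rightarrow> 'a ^ 'n::finite option" where
  "with_z x z = (\<chi> i. case i of None \<Rightarrow> z | Some j \<Rightarrow> x $ j)"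

end

theory Submission
  imports Defs
begin

text \<open>
  Write \<open>N\<close> for the degree of the first non-real homogeneous part of \<open>\<phi>\<close> and \<open>q\<close> for the sum of the
  (real) parts below it.

  Since \<open>p\<close> vanishes on the graph \<open>z = -\<phi>(x)\<close> and has no zeros with all imaginary parts positive,
  \<open>Im \<phi>(x) \<ge> 0\<close> whenever all \<open>Im x\<^sub>i \<ge> 0\<close> and \<open>x\<close> is small. For real \<open>x\<close> the leading part of \<open>Im \<phi>(x)\<close> is
  \<open>Im \<phi>\<^sub>N(x)\<close>, and a nonzero form that is nonnegative on real space has even degree. So \<open>N = 2L\<close>.

  Let \<open>\<J> = (z + q, (x)\<^sup>N)\<close>, and assume that \<open>Im \<phi>\<^sub>N\<close> is positive definite.

  \<open>\<J>\<close> consists of admissible numerators. As \<open>p = u (z + \<phi>)\<close> with \<open>u\<close> a unit, it is enough to bound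
  \<open>x\<^sup>\<alpha>\<close> with \<open>|\<alpha>| = N\<close>, and \<open>z + q = (z + \<phi>) - (\<phi> - q)\<close>, by \<open>|z + \<phi>|\<close>; both bounds follow from
  \<open>\<kappa> |x|\<^sup>N \<le> Im \<phi>(x) \<le> |z + \<phi>(x)|\<close>. The first inequality (\<open>Im_lower_bound_on_halfplane\<close>) is the heart of
  the matter. At \<open>x = a + ib\<close> it compares \<open>Im \<phi>(x)\<close> with \<open>Im \<phi>(a)\<close>, which is at least \<open>c |a|\<^sup>N\<close> by positive
  definiteness; the difference is at least \<open>c' (b\<^sub>1 + \<dots> + b\<^sub>d)\<close> because \<open>\<phi>\<^sub>1\<close> has positive
  coefficients (\<open>linear_coeffs_positive\<close>): on each coordinate axis \<open>\<phi>\<close> is a nonzero one-variable series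
  mapping the upper half plane to its closure near \<open>0\<close>, and such a series must start with a positive
  multiple of the variable.

  Conversely, every series is congruent modulo \<open>\<J>\<close> to a series \<open>h\<close> in \<open>x\<close> alone
  (\<open>reduce_mod_graph_ideal\<close>): since \<open>z \<equiv> -q\<close>, the ideal contains all monomials of total degree \<open>N\<close>,
  which leaves only a polynomial to reduce, by substituting \<open>-q\<close> for \<open>z\<close>. If \<open>f\<close> is
  admissible then so is \<open>h\<close>, hence \<open>|h| \<le> C |p|\<close>, and by continuity this persists at the real points
  \<open>(x, -q(x))\<close>, where \<open>|p|\<close> is of the size of \<open>|\<phi>(x) - q(x)| = O(|x|\<^sup>N)\<close>. Thus \<open>h\<close> vanishes to order \<open>N\<close>
  at \<open>0\<close>, so \<open>h\<close> and \<open>f\<close> lie in \<open>\<J>\<close>.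

  Identities and estimates between values of power series hold only near the origin, so most are
  stated for all points eventually in \<open>nhds 0\<close>, which spares the bookkeeping of radii.
\<close>

section \<open>Evaluation of convergent power series\<close>

lemma polydisc_open: "open (polydisc r :: ('a::real_normed_vector ^ 'v::finite) set)"
proof -
  have "polydisc r = (\<Inter>i\<in>UNIV. {w :: 'a ^ 'v. norm (w $ i) < r})"
    by (auto simp: polydisc_def)
  then show ?thesis
    by (simp add: open_Collect_less continuous_intros open_INT)
qed

lemma eventually_nhds_0_iff_polydisc:
  "(\<forall>\<^sub>F w in nhds (0 :: 'a::real_normed_vector ^ 'v::finite). P w)
    \<longleftrightarrow> (\<exists>r>0. \<forall>w\<in>polydisc r. P w)"
proof
  assume "\<forall>\<^sub>F w in nhds (0 :: 'a ^ 'v). P w"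
  then obtain e where e: "e > 0" "\<And>w :: 'a ^ 'v. dist w 0 < e \<Longrightarrow> P w"
    by (auto simp: eventually_nhds_metric)
  have "P w" if "w \<in> polydisc (e / CARD('v))" for w :: "'a ^ 'v"
  proof (rule e(2))
    have "norm w \<le> (\<Sum>i\<in>UNIV. norm (w $ i))"
      by (simp add: norm_vec_def L2_set_le_sum)
    also have "\<dots> < (\<Sum>i\<in>(UNIV :: 'v set). e / CARD('v))"
      using that by (intro sum_strict_mono) (auto simp: polydisc_def)
    finally show "dist w 0 < e" by simp
  qed
  moreover have "e / CARD('v) > 0" using e(1) by simp
  ultimately show "\<exists>r>0. \<forall>w\<in>polydisc r. P w" by blast
next
  assume "\<exists>r>0. \<forall>w\<in>polydisc r. P w"
  then obtain r where "r > 0" "\<forall>w\<in>polydisc r. P (w :: 'a ^ 'v)" by blast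
  then show "\<forall>\<^sub>F w in nhds (0 :: 'a ^ 'v). P w"
    unfolding eventually_nhds by (intro exI[of _ "polydisc r"]) (simp add: polydisc_open, simp add: polydisc_def)
qed

abbreviation cps_summable_at ::
    "('v::finite, 'a::{real_normed_field, banach}) cps \<Rightarrow> 'a ^ 'v \<Rightarrow> bool" where
  "cps_summable_at f w \<equiv> (\<lambda>\<alpha>. norm (cps_coeff f \<alpha> * monom_eval \<alpha> w)) summable_on UNIV"

lemma eventually_cps_summable_at: "\<forall>\<^sub>F w in nhds 0. cps_summable_at f w"
  using cps_coeff[of f] unfolding eventually_nhds_0_iff_polydisc convergent_coeffs_def by simp

lemma cps_radius_exists:
  fixes f :: "('v::finite, 'a::{real_normed_field, banach}) cps"
  obtains r where "r > 0" "(\<lambda>\<alpha>. norm (cps_coeff f \<alpha>) * r ^ mdeg \<alpha>) summable_on UNIV"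
    "\<forall>w. (\<forall>i. norm (w $ i) \<le> r) \<longrightarrow> cps_summable_at f w"
proof -
  obtain r where r: "r > 0" "(\<lambda>\<alpha>. norm (cps_coeff f \<alpha>) * r ^ mdeg \<alpha>) summable_on UNIV"
    using cps_coeff[of f] by (auto simp: convergent_coeffs_iff)
  have "cps_summable_at f w" if "\<And>i. norm (w $ i) \<le> r" for w
    by (rule Infinite_Sum.abs_summable_on_comparison_test'[OF r(2)])
      (simp add: norm_mult mult_left_mono norm_monom_eval_le that)
  then show ?thesis using r that by blast
qed

lemma cps_coeff_simps [simp]:
  "cps_coeff (f + g) \<alpha> = cps_coeff f \<alpha> + cps_coeff g \<alpha>"
  "cps_coeff (- f) \<alpha> = - cps_coeff f \<alpha>"
  "cps_coeff (f - g) \<alpha> = cps_coeff f \<alpha> - cps_coeff g \<alpha>"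
  "cps_coeff 0 \<alpha> = 0"
  "cps_coeff (cps_hom_part j f) \<alpha> = (if mdeg \<alpha> = j then cps_coeff f \<alpha> else 0)"
proof -
  show p: "cps_coeff (f + g) \<alpha> = cps_coeff f \<alpha> + cps_coeff g \<alpha>" for f g :: "('b, 'a) cps"
    by (simp add: plus_cps.rep_eq)
  show m: "cps_coeff (- f) \<alpha> = - cps_coeff f \<alpha>" for f :: "('b, 'a) cps"
    by (simp add: uminus_cps.rep_eq)
  show "cps_coeff (f - g) \<alpha> = cps_coeff f \<alpha> - cps_coeff g \<alpha>"
    using p[of f "- g"] m[of g] by simp
qed (simp_all add: zero_cps.rep_eq cps_hom_part.rep_eq)

lemma cps_coeff_Im [simp]: "cps_coeff (cps_Im f) \<alpha> = Im (cps_coeff f \<alpha>)"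
  by (simp add: cps_Im.rep_eq)

lemma cps_coeff_sum [simp]: "cps_coeff (sum f A) \<alpha> = (\<Sum>a\<in>A. cps_coeff (f a) \<alpha>)"
  by (induction A rule: infinite_finite_induct) auto

lemma cps_coeff_times:
  "cps_coeff (f * g) \<alpha> = (\<Sum>(\<beta>, \<gamma>) | \<beta> + \<gamma> = \<alpha>. cps_coeff f \<beta> * cps_coeff g \<gamma>)"
  by (simp add: times_cps.rep_eq)

lemma cps_eval_add:
  assumes "cps_summable_at f w" "cps_summable_at g w"
  shows "cps_eval (f + g) w = cps_eval f w + cps_eval g w"
  unfolding cps_eval_def cps_coeff_simps distrib_right
  by (rule infsum_add[OF assms[THEN abs_summable_summable]])

lemma cps_eval_minus: "cps_eval (- f) w = - cps_eval f w"
  unfolding cps_eval_def by (simp add: infsum_uminus)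

text \<open>The Cauchy product: the double series \<open>F \<beta> * G \<gamma>\<close> converges absolutely, and grouping its terms by
  \<open>\<beta> + \<gamma>\<close> gives the product series.\<close>

lemma cps_eval_times:
  assumes f: "cps_summable_at f w" and g: "cps_summable_at g w"
  shows "cps_eval (f * g) w = cps_eval f w * cps_eval g w"
proof -
  define F where "F = (\<lambda>\<alpha>. cps_coeff f \<alpha> * monom_eval \<alpha> w)"
  define G where "G = (\<lambda>\<alpha>. cps_coeff g \<alpha> * monom_eval \<alpha> w)"
  let ?D = "\<lambda>\<alpha>. {(\<beta>, \<gamma>). \<beta> + \<gamma> = (\<alpha> :: 'a \<Rightarrow>\<^sub>0 nat)}"
  let ?H = "\<lambda>(\<beta>, \<gamma>). F \<beta> * G \<gamma>"
  have FG: "(\<lambda>\<alpha>. norm (F \<alpha>)) summable_on UNIV" "(\<lambda>\<alpha>. norm (G \<alpha>)) summable_on UNIV"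
    using f g by (simp_all add: F_def G_def)
  have "(\<lambda>x. norm (?H x)) summable_on (UNIV \<times> UNIV)"
    by (subst Infinite_Sum.abs_summable_on_Sigma_iff)
      (auto simp: norm_mult infsum_cmult_right' abs_mult infsum_nonneg
        intro!: summable_on_cmult_right summable_on_cmult_left FG)
  then have sH: "?H summable_on (UNIV \<times> UNIV)" by (rule abs_summable_summable)
  have bij: "bij_betw snd (Sigma UNIV ?D) (UNIV \<times> UNIV)"
    by (rule bij_betw_byWitness[of _ "\<lambda>x. (fst x + snd x, x)"]) auto
  have "cps_eval (f * g) w = (\<Sum>\<^sub>\<infinity>\<alpha>. \<Sum>\<^sub>\<infinity>x\<in>?D \<alpha>. ?H x)"
    unfolding cps_eval_def
  proof (rule infsum_cong)
    fix \<alpha>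
    have "monom_eval (\<beta> + \<gamma>) w = monom_eval \<beta> w * monom_eval \<gamma> w" for \<beta> \<gamma>
      by (simp add: monom_eval_def lookup_add power_add prod.distrib)
    then show "cps_coeff (f * g) \<alpha> * monom_eval \<alpha> w = (\<Sum>\<^sub>\<infinity>x\<in>?D \<alpha>. ?H x)"
      by (subst infsum_finite) (auto simp: finite_add_decomp cps_coeff_times sum_distrib_right F_def G_def
          intro!: sum.cong)
  qed
  also have "\<dots> = (\<Sum>\<^sub>\<infinity>x\<in>Sigma UNIV ?D. ?H (snd x))"
    using sH by (subst infsum_Sigma_banach[symmetric])
      (simp_all add: summable_on_reindex_bij_betw[OF bij])
  also have "\<dots> = infsum ?H (UNIV \<times> UNIV)"
    by (rule infsum_reindex_bij_betw[OF bij])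
  also have "\<dots> = (\<Sum>\<^sub>\<infinity>\<beta>. \<Sum>\<^sub>\<infinity>\<gamma>. F \<beta> * G \<gamma>)"
    using infsum_Sigma_banach[OF sH] by simp
  also have "\<dots> = infsum F UNIV * infsum G UNIV"
    by (simp add: infsum_cmult_right' infsum_cmult_left')
  finally show ?thesis by (simp add: F_def G_def cps_eval_def)
qed

lemma finite_mdeg: "finite {\<alpha> :: 'v::finite \<Rightarrow>\<^sub>0 nat. mdeg \<alpha> = j}"
proof -
  have "Poly_Mapping.lookup ` {\<alpha> :: 'v \<Rightarrow>\<^sub>0 nat. mdeg \<alpha> = j} \<subseteq> PiE UNIV (\<lambda>_. {..j})"
    by (auto simp: PiE_UNIV_domain mdeg_def intro!: member_le_sum)
  then show ?thesis
    by (rule inj_on_finite[rotated]) (auto simp: inj_on_def intro: poly_mapping_eqI finite_PiE)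
qed

lemma cps_eval_finite_support:
  assumes "finite S" "\<And>\<alpha>. \<alpha> \<notin> S \<Longrightarrow> cps_coeff f \<alpha> = 0"
  shows "cps_eval f w = (\<Sum>\<alpha>\<in>S. cps_coeff f \<alpha> * monom_eval \<alpha> w)" "cps_summable_at f w"
proof -
  have "cps_eval f w = (\<Sum>\<^sub>\<infinity>\<alpha>\<in>S. cps_coeff f \<alpha> * monom_eval \<alpha> w)"
    unfolding cps_eval_def by (rule infsum_cong_neutral) (use assms in auto)
  then show "cps_eval f w = (\<Sum>\<alpha>\<in>S. cps_coeff f \<alpha> * monom_eval \<alpha> w)" using assms(1) by simp
  have "(\<lambda>\<alpha>. norm (cps_coeff f \<alpha> * monom_eval \<alpha> w)) summable_on S" using assms(1) by simp
  then show "cps_summable_at f w"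
    by (rule summable_on_cong_neutral[THEN iffD1, rotated -1]) (use assms in auto)
qed

lemma cps_eval_hom_part:
  "cps_eval (cps_hom_part j f) w = (\<Sum>\<alpha> | mdeg \<alpha> = j. cps_coeff f \<alpha> * monom_eval \<alpha> w)"
  by (subst cps_eval_finite_support(1)[OF finite_mdeg[of j]]) (auto intro!: sum.cong)

lemma cps_summable_at_hom_part: "cps_summable_at (cps_hom_part j f) w"
  by (rule cps_eval_finite_support(2)[OF finite_mdeg[of j]]) auto

lemma monom_eval_scale:
  fixes w :: "'a::real_normed_field ^ 'v::finite"
  shows "monom_eval \<alpha> (c *s w) = c ^ mdeg \<alpha> * monom_eval \<alpha> w"
  by (simp add: monom_eval_def mdeg_def power_mult_distrib prod.distrib power_sum)

lemma cps_eval_hom_part_scale: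
  "cps_eval (cps_hom_part j f) (c *s w) = c ^ j * cps_eval (cps_hom_part j f) w"
  unfolding cps_eval_hom_part sum_distrib_left
  by (rule sum.cong) (auto simp: monom_eval_scale)

text \<open>For \<open>|w| \<le> r\<close> each term of degree \<open>n \<ge> M\<close> shrinks by the factor \<open>(|w| / r)\<^sup>n \<le> (|w| / r)\<^sup>M\<close> compared
  with its value on the polyradius \<open>r\<close>.\<close>

lemma cps_order_bound:
  fixes f :: "('v::finite, 'a::{real_normed_field, banach}) cps"
  assumes "\<And>\<alpha>. mdeg \<alpha> < M \<Longrightarrow> cps_coeff f \<alpha> = 0"
  shows "\<exists>C. \<forall>\<^sub>F w in nhds 0. norm (cps_eval f w) \<le> C * norm w ^ M"
proof -
  obtain r where r: "r > 0" "(\<lambda>\<alpha>. norm (cps_coeff f \<alpha>) * r ^ mdeg \<alpha>) summable_on UNIV"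
    "\<forall>w. (\<forall>i. norm (w $ i) \<le> r) \<longrightarrow> cps_summable_at f w"
    by (rule cps_radius_exists)
  let ?A = "\<lambda>\<alpha>. norm (cps_coeff f \<alpha>) * r ^ mdeg \<alpha>"
  have bound: "norm (cps_eval f w) \<le> (infsum ?A UNIV / r ^ M) * norm w ^ M" if w: "norm w < r" for w
  proof -
    have comp: "norm (w $ i) \<le> norm w" for i by (rule Finite_Cartesian_Product.norm_nth_le)
    have "norm (cps_coeff f \<alpha> * monom_eval \<alpha> w) \<le> (norm w / r) ^ M * ?A \<alpha>" for \<alpha>
    proof (cases "mdeg \<alpha> < M")
      case False
      have "norm (monom_eval \<alpha> w) \<le> norm w ^ mdeg \<alpha>"
        by (intro norm_monom_eval_le comp)
      also have "\<dots> = (norm w / r) ^ mdeg \<alpha> * r ^ mdeg \<alpha>"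
        using r(1) by (simp add: power_divide)
      also have "\<dots> \<le> (norm w / r) ^ M * r ^ mdeg \<alpha>"
        using False r(1) w by (intro mult_right_mono power_decreasing) auto
      finally show ?thesis by (simp add: norm_mult mult_left_mono mult.left_commute)
    qed (simp add: assms)
    moreover have "cps_summable_at f w"
      using comp w by (intro r(3)[rule_format]) (meson order_trans less_imp_le)
    then have "(\<lambda>\<alpha>. cps_coeff f \<alpha> * monom_eval \<alpha> w) summable_on UNIV"
      by (rule abs_summable_summable)
    ultimately have "norm (cps_eval f w) \<le> (norm w / r) ^ M * infsum ?A UNIV"
      unfolding cps_eval_def
      by (intro norm_infsum_le[OF has_sum_infsum has_sum_cmult_right[OF has_sum_infsum[OF r(2)]]])
    then show ?thesis by (simp add: power_divide mult.commute)
  qed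
  have "\<forall>\<^sub>F w in nhds (0 :: 'a ^ 'v). norm w < r"
    using r(1) by (auto simp: eventually_nhds_metric)
  then show ?thesis using bound by (blast intro: eventually_mono)
qed

text \<open>A monomial of degree \<open>n\<close> is a product of \<open>n\<close> factors, exchanged one at a time; rescaling by \<open>1 / \<rho>\<close>
  reduces to factors of norm at most \<open>1\<close>.\<close>

lemma norm_monom_eval_diff_le:
  fixes v w :: "'a::real_normed_field ^ 'v::finite" and \<rho> :: real
  assumes "\<rho> > 0" "\<And>i. norm (w $ i) \<le> \<rho>" "\<And>i. norm (v $ i) \<le> \<rho>"
  shows "norm (monom_eval \<alpha> w - monom_eval \<alpha> v)
    \<le> mdeg \<alpha> * \<rho> ^ mdeg \<alpha> * ((\<Sum>i\<in>UNIV. norm (w $ i - v $ i)) / \<rho>)"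
proof -
  define c where "c = (of_real (1 / \<rho>) :: 'a)"
  define a where "a = Poly_Mapping.lookup \<alpha>"
  have nc: "norm c = 1 / \<rho>" using assms(1) unfolding c_def norm_of_real by simp
  have le1: "norm ((c *s x) $ i) \<le> 1" if "\<And>i. norm (x $ i) \<le> \<rho>" for x :: "'a ^ 'v" and i
    using that[of i] assms(1) by (simp add: norm_mult nc)
  have scale: "x = of_real \<rho> *s (c *s x)" for x :: "'a ^ 'v"
    using assms(1) by (simp add: vec_eq_iff c_def)
  have "norm (monom_eval \<alpha> (c *s w) - monom_eval \<alpha> (c *s v))
      \<le> (\<Sum>i\<in>UNIV. norm ((c *s w) $ i ^ a i - (c *s v) $ i ^ a i))"
    unfolding monom_eval_def a_def[symmetric]
    by (intro norm_prod_diff) (simp_all only: norm_power power_le_one norm_ge_zero le1 assms)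
  also have "\<dots> \<le> (\<Sum>i\<in>UNIV. mdeg \<alpha> * (norm (w $ i - v $ i) / \<rho>))"
  proof (rule sum_mono)
    fix i
    have "norm ((c *s w) $ i ^ a i - (c *s v) $ i ^ a i) \<le> a i * norm ((c *s w) $ i - (c *s v) $ i)"
      by (rule norm_power_diff) (intro le1 assms)+
    also have "norm ((c *s w) $ i - (c *s v) $ i) = norm (w $ i - v $ i) / \<rho>"
      by (simp add: nc norm_mult right_diff_distrib[symmetric])
    also have "a i * \<dots> \<le> mdeg \<alpha> * \<dots>"
      using assms(1) by (intro mult_right_mono) (auto simp: mdeg_def a_def intro: member_le_sum)
    finally show "norm ((c *s w) $ i ^ a i - (c *s v) $ i ^ a i) \<le> mdeg \<alpha> * (norm (w $ i - v $ i) / \<rho>)" .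
  qed
  finally have le: "norm (monom_eval \<alpha> (c *s w) - monom_eval \<alpha> (c *s v))
      \<le> mdeg \<alpha> * ((\<Sum>i\<in>UNIV. norm (w $ i - v $ i)) / \<rho>)"
    by (simp add: sum_distrib_left sum_divide_distrib)
  have "monom_eval \<alpha> w - monom_eval \<alpha> v
      = of_real (\<rho> ^ mdeg \<alpha>) * (monom_eval \<alpha> (c *s w) - monom_eval \<alpha> (c *s v))"
    by (subst (1) scale[of w], subst (1) scale[of v], subst (1 2) monom_eval_scale)
      (simp add: right_diff_distrib)
  then have "norm (monom_eval \<alpha> w - monom_eval \<alpha> v)
      = \<rho> ^ mdeg \<alpha> * norm (monom_eval \<alpha> (c *s w) - monom_eval \<alpha> (c *s v))"
    using assms(1) by (simp add: norm_mult norm_power)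
  also have "\<dots> \<le> \<rho> ^ mdeg \<alpha> * (mdeg \<alpha> * ((\<Sum>i\<in>UNIV. norm (w $ i - v $ i)) / \<rho>))"
    using assms(1) le by (intro mult_left_mono) auto
  finally show ?thesis by (simp add: mult_ac)
qed

text \<open>This replaces a bound on the first derivatives, which are \<open>O(\<rho>\<^sup>m)\<close> on the polydisc of radius \<open>\<rho>\<close> if the
  parts of degree \<open>1, \<dots>, m\<close> are absent. The case \<open>m = 0\<close> gives continuity; the case \<open>m = 1\<close> controls
  the nonlinear part of \<open>\<phi>\<close>.\<close>

lemma cps_Lipschitz:
  fixes f :: "('v::finite, 'a::{real_normed_field, banach}) cps"
  assumes "\<And>\<alpha>. 0 < mdeg \<alpha> \<Longrightarrow> mdeg \<alpha> \<le> m \<Longrightarrow> cps_coeff f \<alpha> = 0"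
  obtains C r where "C \<ge> 0" "r > 0"
    "\<forall>\<rho> w v. 0 < \<rho> \<longrightarrow> \<rho> \<le> r \<longrightarrow> (\<forall>i. norm (w $ i) \<le> \<rho>) \<longrightarrow> (\<forall>i. norm (v $ i) \<le> \<rho>) \<longrightarrow>
      norm (cps_eval f w - cps_eval f v) \<le> C * \<rho> ^ m * (\<Sum>i\<in>UNIV. norm (w $ i - v $ i))"
proof -
  obtain r where r: "r > 0" "(\<lambda>\<alpha>. norm (cps_coeff f \<alpha>) * r ^ mdeg \<alpha>) summable_on UNIV"
    "\<forall>w. (\<forall>i. norm (w $ i) \<le> r) \<longrightarrow> cps_summable_at f w"
    by (rule cps_radius_exists)
  let ?A = "\<lambda>\<alpha>. norm (cps_coeff f \<alpha>) * r ^ mdeg \<alpha>"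
  define C where "C = infsum ?A UNIV * (2 / r) ^ Suc m"
  have "norm (cps_eval f w - cps_eval f v) \<le> C * \<rho> ^ m * (\<Sum>i\<in>UNIV. norm (w $ i - v $ i))"
    if \<rho>: "0 < \<rho>" "\<rho> \<le> r / 2" and w: "\<And>i. norm (w $ i) \<le> \<rho>" and v: "\<And>i. norm (v $ i) \<le> \<rho>"
    for \<rho> and w v :: "'a ^ 'v"
  proof -
    define D where "D = (\<Sum>i\<in>UNIV. norm (w $ i - v $ i))"
    have D0: "D \<ge> 0" by (simp add: D_def sum_nonneg)
    have "norm (w $ i) \<le> r" "norm (v $ i) \<le> r" for i
      using w[of i] v[of i] \<rho> by linarith+
    then have "cps_summable_at f w" "cps_summable_at f v"
      using r(3) by blast+
    then have sw: "(\<lambda>\<alpha>. cps_coeff f \<alpha> * monom_eval \<alpha> w) summable_on UNIV"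
      "(\<lambda>\<alpha>. cps_coeff f \<alpha> * monom_eval \<alpha> v) summable_on UNIV"
      by (blast intro: abs_summable_summable)+
    have term_le: "norm (cps_coeff f \<alpha> * monom_eval \<alpha> w - cps_coeff f \<alpha> * monom_eval \<alpha> v)
        \<le> ((2 / r) ^ Suc m * \<rho> ^ m * D) * ?A \<alpha>" for \<alpha>
    proof (cases "Suc m \<le> mdeg \<alpha>")
      case True
      let ?n = "mdeg \<alpha>"
      \<comment> \<open>the factor \<open>n\<close> produced by differentiation is absorbed by halving the radius\<close>
      have "?n * \<rho> ^ ?n = (?n / 2 ^ ?n) * ((2 * \<rho> / r) ^ ?n * r ^ ?n)"
        using r(1) by (simp add: power_divide power_mult_distrib)
      also have "\<dots> \<le> 1 * ((2 * \<rho> / r) ^ Suc m * r ^ ?n)"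
      proof (rule mult_mono)
        have "real ?n < 2 ^ ?n" by simp
        then show "?n / 2 ^ ?n \<le> 1" by (simp add: divide_le_eq)
        show "(2 * \<rho> / r) ^ ?n * r ^ ?n \<le> (2 * \<rho> / r) ^ Suc m * r ^ ?n"
          using \<rho> r(1) True by (intro mult_right_mono power_decreasing) (simp_all add: divide_le_eq)
      qed (use \<rho> r(1) in simp_all)
      finally have "?n * \<rho> ^ ?n \<le> (2 * \<rho> / r) ^ Suc m * r ^ ?n" by simp
      then have *: "?n * \<rho> ^ ?n * (D / \<rho>) \<le> (2 * \<rho> / r) ^ Suc m * r ^ ?n * (D / \<rho>)"
        using \<rho> D0 by (intro mult_right_mono) auto
      have "norm (cps_coeff f \<alpha> * monom_eval \<alpha> w - cps_coeff f \<alpha> * monom_eval \<alpha> v)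
          = norm (cps_coeff f \<alpha>) * norm (monom_eval \<alpha> w - monom_eval \<alpha> v)"
        by (simp add: norm_mult right_diff_distrib[symmetric])
      also have "\<dots> \<le> norm (cps_coeff f \<alpha>) * (?n * \<rho> ^ ?n * (D / \<rho>))"
        unfolding D_def by (intro mult_left_mono norm_monom_eval_diff_le \<rho> w v) auto
      also have "\<dots> \<le> norm (cps_coeff f \<alpha>) * ((2 * \<rho> / r) ^ Suc m * r ^ ?n * (D / \<rho>))"
        using * by (rule mult_left_mono) simp
      also have "\<dots> = ((2 / r) ^ Suc m * \<rho> ^ m * D) * ?A \<alpha>"
        using \<rho> by (simp add: power_mult_distrib power_divide field_simps)
      finally show ?thesis .
    next
      case False
      then have "mdeg \<alpha> = 0 \<or> cps_coeff f \<alpha> = 0" using assms by force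
      then have *: "cps_coeff f \<alpha> * monom_eval \<alpha> w = cps_coeff f \<alpha> * monom_eval \<alpha> v"
        by (auto simp: mdeg_def monom_eval_def)
      show ?thesis unfolding * using \<rho> r(1) D0 by simp
    qed
    have diff: "((\<lambda>\<alpha>. cps_coeff f \<alpha> * monom_eval \<alpha> w - cps_coeff f \<alpha> * monom_eval \<alpha> v) has_sum
        ((\<Sum>\<^sub>\<infinity>\<alpha>. cps_coeff f \<alpha> * monom_eval \<alpha> w) - (\<Sum>\<^sub>\<infinity>\<alpha>. cps_coeff f \<alpha> * monom_eval \<alpha> v))) UNIV"
      using has_sum_add[OF has_sum_infsum[OF sw(1)] has_sum_uminusI[OF has_sum_infsum[OF sw(2)]]]
      by simp
    have "norm (cps_eval f w - cps_eval f v)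
        \<le> ((2 / r) ^ Suc m * \<rho> ^ m * D) * infsum ?A UNIV"
      unfolding cps_eval_def
      by (rule norm_infsum_le[OF diff has_sum_cmult_right[OF has_sum_infsum[OF r(2)]] term_le])
    then show ?thesis by (simp add: C_def D_def mult_ac)
  qed
  then have "\<forall>\<rho> w v. 0 < \<rho> \<longrightarrow> \<rho> \<le> r / 2 \<longrightarrow> (\<forall>i. norm (w $ i) \<le> \<rho>) \<longrightarrow> (\<forall>i. norm (v $ i) \<le> \<rho>) \<longrightarrow>
      norm (cps_eval f w - cps_eval f v) \<le> C * \<rho> ^ m * (\<Sum>i\<in>UNIV. norm (w $ i - v $ i))"
    by blast
  moreover have "C \<ge> 0" unfolding C_def using r(1) by (intro mult_nonneg_nonneg infsum_nonneg) auto
  moreover have "r / 2 > 0" using r(1) by simp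
  ultimately show ?thesis by (rule that[rotated 2])
qed

lemma eventually_cps_eval_add:
  "\<forall>\<^sub>F w in nhds 0. cps_eval (f + g) w = cps_eval f w + cps_eval g w"
  using eventually_cps_summable_at[of f] eventually_cps_summable_at[of g]
  by eventually_elim (rule cps_eval_add)

lemma eventually_cps_eval_diff:
  "\<forall>\<^sub>F w in nhds 0. cps_eval (f - g) w = cps_eval f w - cps_eval g w"
  using eventually_cps_eval_add[of f "- g"] by eventually_elim (simp add: cps_eval_minus)

lemma eventually_cps_eval_times:
  "\<forall>\<^sub>F w in nhds 0. cps_eval (f * g) w = cps_eval f w * cps_eval g w"
  using eventually_cps_summable_at[of f] eventually_cps_summable_at[of g]
  by eventually_elim (rule cps_eval_times)

lemma eventually_cps_eval_sum_hom_parts: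
  "\<forall>\<^sub>F w in nhds 0. cps_eval (\<Sum>j\<in>A. cps_hom_part j f) w = (\<Sum>j\<in>A. cps_eval (cps_hom_part j f) w)"
proof (induction A rule: infinite_finite_induct)
  case (insert j A)
  show ?case
    using insert.IH eventually_cps_eval_add[of "cps_hom_part j f" "\<Sum>j\<in>A. cps_hom_part j f"]
    by eventually_elim (use insert.hyps in simp)
qed (simp_all add: cps_eval_def)

lemma cps_eval_0:
  fixes f :: "('v::finite, 'a::{real_normed_field, banach}) cps"
  shows "cps_eval f 0 = cps_coeff f 0"
proof -
  have "monom_eval \<alpha> 0 = (if \<alpha> = 0 then 1 else 0 :: 'a)" for \<alpha> :: "'v \<Rightarrow>\<^sub>0 nat"
    by (auto simp: monom_eval_def poly_mapping_eq_iff fun_eq_iff)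
  then have "cps_eval f 0 = (\<Sum>\<^sub>\<infinity>\<alpha>\<in>{0}. cps_coeff f \<alpha>)"
    unfolding cps_eval_def by (intro infsum_cong_neutral) auto
  then show ?thesis by simp
qed

section \<open>Leading terms along lines and the identity theorem\<close>

text \<open>Along the line through \<open>w\<close> the homogeneous parts become powers of \<open>t\<close>, and what lies beyond degree \<open>k\<close>
  is \<open>O(t\<^sup>k\<^sup>+\<^sup>1)\<close>.\<close>

lemma cps_leading_term_on_line:
  fixes f :: "('v::finite, 'a::{real_normed_field, banach}) cps" and w :: "'a ^ 'v"
  assumes lower: "\<And>j. j < k \<Longrightarrow> cps_eval (cps_hom_part j f) w = 0"
  shows "((\<lambda>t. cps_eval f (t *\<^sub>R w) / of_real t ^ k) \<longlongrightarrow> cps_eval (cps_hom_part k f) w) (at 0)"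
proof -
  define T where "T = (\<Sum>j\<le>k. cps_hom_part j f)"
  have "cps_coeff (f - T) \<alpha> = 0" if "mdeg \<alpha> < Suc k" for \<alpha>
    using that by (simp add: T_def)
  then obtain C where C: "\<forall>\<^sub>F v in nhds 0. norm (cps_eval (f - T) v) \<le> C * norm v ^ Suc k"
    using cps_order_bound[of "Suc k" "f - T"] by blast
  have lim: "filterlim (\<lambda>t. t *\<^sub>R w) (nhds 0) (at 0)"
    by (auto intro!: tendsto_eq_intros)
  have scale: "t *\<^sub>R w = of_real t *s w" for t
    unfolding vec_eq_iff vector_scaleR_component by (simp add: scaleR_conv_of_real)
  have "\<forall>\<^sub>F t in at 0. norm (cps_eval f (t *\<^sub>R w) / of_real t ^ k - cps_eval (cps_hom_part k f) w)
      \<le> C * norm w ^ Suc k * \<bar>t\<bar>"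
    using filterlim_iff[THEN iffD1, OF lim, rule_format, OF C]
      filterlim_iff[THEN iffD1, OF lim, rule_format, OF eventually_cps_eval_diff[of f T]]
      filterlim_iff[THEN iffD1, OF lim, rule_format, OF eventually_cps_eval_sum_hom_parts[of f "{..k}"]]
      eventually_neq_at_within[of 0]
  proof eventually_elim
    case (elim t)
    have "cps_eval T (t *\<^sub>R w) = (\<Sum>j\<le>k. of_real t ^ j * cps_eval (cps_hom_part j f) w)"
      using elim(3) unfolding T_def scale cps_eval_hom_part_scale .
    also have "\<dots> = of_real t ^ k * cps_eval (cps_hom_part k f) w"
      by (subst sum.mono_neutral_right[of _ "{k}"]) (use lower in auto)
    finally have "cps_eval f (t *\<^sub>R w) / of_real t ^ k - cps_eval (cps_hom_part k f) w
        = cps_eval (f - T) (t *\<^sub>R w) / of_real t ^ k"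
      using elim(2,4) by (simp add: field_simps)
    also have "norm \<dots> \<le> (C * norm (t *\<^sub>R w) ^ Suc k) / \<bar>t\<bar> ^ k"
      unfolding norm_divide norm_power norm_of_real using elim(1) by (rule divide_right_mono) simp
    also have "\<dots> = C * norm w ^ Suc k * \<bar>t\<bar>"
      using elim(4) by (simp add: power_mult_distrib field_simps)
    finally show ?case .
  qed
  moreover have "((\<lambda>t. C * norm w ^ Suc k * \<bar>t\<bar>) \<longlongrightarrow> 0) (at 0)"
    by (auto intro!: tendsto_eq_intros)
  ultimately have "((\<lambda>t. cps_eval f (t *\<^sub>R w) / of_real t ^ k - cps_eval (cps_hom_part k f) w) \<longlongrightarrow> 0) (at 0)"
    by (rule Lim_null_comparison)
  then show ?thesis by (rule LIM_zero_cancel)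
qed

definition vec_of_real :: "real ^ 'v \<Rightarrow> 'a::real_normed_field ^ 'v::finite" where
  "vec_of_real x = (\<chi> i. of_real (x $ i))"

lemma vec_of_real_nth [simp]: "vec_of_real x $ i = of_real (x $ i)"
  by (simp add: vec_of_real_def)

lemma vec_of_real_scaleR: "vec_of_real (t *\<^sub>R x) = t *\<^sub>R vec_of_real x"
  unfolding vec_eq_iff vector_scaleR_component vec_of_real_nth by (simp add: scaleR_conv_of_real)

lemma norm_vec_of_real: "norm (vec_of_real x :: 'a::real_normed_field ^ 'v::finite) = norm x"
  by (simp add: norm_vec_def)

lemma tendsto_vec_of_real: "filterlim vec_of_real (nhds (0 :: 'a::real_normed_field ^ 'v::finite)) (nhds 0)"
  by (rule vec_tendstoI) (auto intro!: tendsto_eq_intros filterlim_ident)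

text \<open>Induction on the set \<open>A\<close> of variables that occur: for fixed values of the others, the sum is a
  polynomial in the new variable with infinitely many roots, so each of its coefficients, which is a sum
  in fewer variables, vanishes. Restricting \<open>F\<close> to a fixed exponent of the new variable keeps its
  elements distinguishable by the remaining ones.\<close>

lemma polynomial_coeffs_zero_aux:
  fixes c :: "('v::finite \<Rightarrow>\<^sub>0 nat) \<Rightarrow> 'a::real_normed_field"
  assumes "finite A" "finite F"
    and "\<And>\<alpha> \<beta>. \<alpha> \<in> F \<Longrightarrow> \<beta> \<in> F \<Longrightarrow>
      (\<And>i. i \<in> A \<Longrightarrow> Poly_Mapping.lookup \<alpha> i = Poly_Mapping.lookup \<beta> i) \<Longrightarrow> \<alpha> = \<beta>"
    and "\<And>x :: 'v \<Rightarrow> real. (\<Sum>\<alpha>\<in>F. c \<alpha> * (\<Prod>i\<in>A. of_real (x i) ^ Poly_Mapping.lookup \<alpha> i)) = 0"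
    and "\<alpha> \<in> F"
  shows "c \<alpha> = 0"
  using assms
proof (induction A arbitrary: F \<alpha> rule: finite_induct)
  case empty
  then have "F = {\<alpha>}" by auto
  then show ?case using empty.prems(3) by simp
next
  case (insert i A)
  let ?lk = "Poly_Mapping.lookup :: ('v \<Rightarrow>\<^sub>0 nat) \<Rightarrow> _"
  let ?G = "\<lambda>k. {\<beta>\<in>F. ?lk \<beta> i = k}"
  have zero: "(\<Sum>\<beta>\<in>?G k. c \<beta> * (\<Prod>j\<in>A. of_real (x j) ^ ?lk \<beta> j)) = 0" for k and x :: "'v \<Rightarrow> real"
  proof -
    define n where "n = Max (insert k ((\<lambda>\<beta>. ?lk \<beta> i) ` F))"
    define d where "d k = (\<Sum>\<beta>\<in>?G k. c \<beta> * (\<Prod>j\<in>A. of_real (x j) ^ ?lk \<beta> j))" for k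
    have n: "k \<le> n" "(\<lambda>\<beta>. ?lk \<beta> i) ` F \<subseteq> {..n}"
      using insert.prems(1) by (auto simp: n_def intro!: Max_ge)
    have "(\<Sum>l\<le>n. d l * of_real t ^ l) = 0" for t :: real
    proof -
      have "(\<Sum>l\<le>n. d l * of_real t ^ l)
          = (\<Sum>l\<le>n. \<Sum>\<beta>\<in>?G l. c \<beta> * (\<Prod>j\<in>insert i A. of_real ((x(i := t)) j) ^ ?lk \<beta> j))"
        unfolding d_def sum_distrib_right
      proof (intro sum.cong refl)
        fix l \<beta> assume "\<beta> \<in> ?G l"
        moreover have "(\<Prod>j\<in>A. of_real ((x(i := t)) j) ^ ?lk \<beta> j) = (\<Prod>j\<in>A. of_real (x j) ^ ?lk \<beta> j :: 'a)"
          using insert.hyps by (intro prod.cong) auto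
        ultimately show "c \<beta> * (\<Prod>j\<in>A. of_real (x j) ^ ?lk \<beta> j) * of_real t ^ l
            = c \<beta> * (\<Prod>j\<in>insert i A. of_real ((x(i := t)) j) ^ ?lk \<beta> j)"
          using insert.hyps by simp
      qed
      also have "\<dots> = (\<Sum>\<beta>\<in>F. c \<beta> * (\<Prod>j\<in>insert i A. of_real ((x(i := t)) j) ^ ?lk \<beta> j))"
        using insert.prems(1) n(2) by (intro sum.group) auto
      finally show ?thesis using insert.prems(3) by simp
    qed
    then have "range of_real \<subseteq> {z. (\<Sum>l\<le>n. d l * z ^ l) = 0}" by auto
    moreover have "infinite (range (of_real :: real \<Rightarrow> 'a))"
      using infinite_UNIV_char_0[where 'a = real] by (auto simp: finite_image_iff inj_def)
    ultimately have "infinite {z. (\<Sum>l\<le>n. d l * z ^ l) = 0}" using finite_subset by blast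
    then have "d k = 0" using polyfun_finite_roots[of d n] n(1) by blast
    then show ?thesis by (simp add: d_def)
  qed
  show ?case
  proof (rule insert.IH)
    show "finite (?G (?lk \<alpha> i))" using insert.prems(1) by simp
    show "\<alpha> \<in> ?G (?lk \<alpha> i)" using insert.prems(4) by simp
  next
    fix \<beta> \<gamma> assume "\<beta> \<in> ?G (?lk \<alpha> i)" "\<gamma> \<in> ?G (?lk \<alpha> i)" "\<And>j. j \<in> A \<Longrightarrow> ?lk \<beta> j = ?lk \<gamma> j"
    then show "\<beta> = \<gamma>" by (intro insert.prems(2)) auto
  qed (rule zero)
qed

lemma cps_hom_part_zero_if_zero_on_reals:
  fixes f :: "('v::finite, 'a::{real_normed_field, banach}) cps"
  assumes "\<And>x :: real ^ 'v. cps_eval (cps_hom_part k f) (vec_of_real x) = 0" and "mdeg \<alpha> = k"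
  shows "cps_coeff f \<alpha> = 0"
proof (rule polynomial_coeffs_zero_aux[of UNIV "{\<alpha>. mdeg \<alpha> = k}"])
  fix x :: "'v \<Rightarrow> real"
  show "(\<Sum>\<alpha>\<in>{\<alpha>. mdeg \<alpha> = k}. cps_coeff f \<alpha> * (\<Prod>i\<in>UNIV. of_real (x i) ^ Poly_Mapping.lookup \<alpha> i)) = 0"
    using assms(1)[of "\<chi> i. x i"] by (simp add: cps_eval_hom_part monom_eval_def)
qed (use assms(2) finite_mdeg in \<open>auto intro: poly_mapping_eqI\<close>)

text \<open>By induction on the degree, the homogeneous part of degree \<open>k < M\<close> is the leading term along every
  real line, and the bound forces that term to vanish.\<close>

lemma cps_coeffs_zero_if_bound_on_reals:
  fixes f :: "('v::finite, 'a::{real_normed_field, banach}) cps"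
  assumes bound: "\<forall>\<^sub>F x in nhds (0 :: real ^ 'v). norm (cps_eval f (vec_of_real x)) \<le> C * norm x ^ M"
    and "mdeg \<alpha> < M"
  shows "cps_coeff f \<alpha> = 0"
  using \<open>mdeg \<alpha> < M\<close>
proof (induction "mdeg \<alpha>" arbitrary: \<alpha> rule: less_induct)
  case less
  define k where "k = mdeg \<alpha>"
  have "cps_eval (cps_hom_part k f) (vec_of_real x) = 0" for x :: "real ^ 'v"
  proof (rule tendsto_unique)
    show "((\<lambda>t. cps_eval f (t *\<^sub>R vec_of_real x) / of_real t ^ k)
        \<longlongrightarrow> cps_eval (cps_hom_part k f) (vec_of_real x)) (at 0)"
    proof (rule cps_leading_term_on_line)
      fix j assume "j < k"
      then have "cps_coeff f \<beta> = 0" if "mdeg \<beta> = j" for \<beta>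
        using less that by (simp add: k_def)
      then show "cps_eval (cps_hom_part j f) (vec_of_real x) = 0" by (simp add: cps_eval_hom_part)
    qed
    have lim: "filterlim (\<lambda>t. t *\<^sub>R x) (nhds 0) (at 0)"
      by (auto intro!: tendsto_eq_intros)
    have "\<forall>\<^sub>F t in at 0. norm (cps_eval f (t *\<^sub>R vec_of_real x) / of_real t ^ k)
        \<le> C * norm x ^ M * \<bar>t\<bar> ^ (M - k)"
      using filterlim_iff[THEN iffD1, OF lim, rule_format, OF bound] eventually_neq_at_within[of 0]
    proof eventually_elim
      case (elim t)
      have "norm (cps_eval f (t *\<^sub>R vec_of_real x) / of_real t ^ k)
          \<le> (C * norm (t *\<^sub>R x) ^ M) / \<bar>t\<bar> ^ k"
        unfolding norm_divide norm_power norm_of_real using elim(1)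
        by (intro divide_right_mono) (simp_all add: vec_of_real_scaleR)
      also have "\<dots> = C * norm x ^ M * \<bar>t\<bar> ^ (M - k)"
        using elim(2) less.prems by (simp add: power_mult_distrib power_diff k_def)
      finally show ?case .
    qed
    moreover have "((\<lambda>t. C * norm x ^ M * \<bar>t\<bar> ^ (M - k)) \<longlongrightarrow> 0) (at 0)"
      using less.prems by (auto intro!: tendsto_eq_intros simp: k_def)
    ultimately show "((\<lambda>t. cps_eval f (t *\<^sub>R vec_of_real x) / of_real t ^ k) \<longlongrightarrow> 0) (at 0)"
      by (rule Lim_null_comparison)
  qed simp
  then show ?case using cps_hom_part_zero_if_zero_on_reals k_def by blast
qed

text \<open>Identities in the ring of power series can therefore be proved by evaluating both sides near \<open>0\<close>.\<close>

lemma cps_eqI_eval: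
  fixes f g :: "('v::finite, 'a::{real_normed_field, banach}) cps"
  assumes "\<forall>\<^sub>F w in nhds 0. cps_eval f w = cps_eval g w"
  shows "f = g"
proof (rule cps_eqI)
  fix \<alpha> :: "'v \<Rightarrow>\<^sub>0 nat"
  have "\<forall>\<^sub>F w in nhds 0. cps_eval (f - g) w = 0"
    using assms eventually_cps_eval_diff[of f g] by eventually_elim simp
  then have "\<forall>\<^sub>F x in nhds (0 :: real ^ 'v). cps_eval (f - g) (vec_of_real x) = 0"
    using tendsto_vec_of_real by (auto simp: filterlim_iff)
  then have "\<forall>\<^sub>F x in nhds (0 :: real ^ 'v). norm (cps_eval (f - g) (vec_of_real x)) \<le> 0 * norm x ^ Suc (mdeg \<alpha>)"
    by eventually_elim simp
  from cps_coeffs_zero_if_bound_on_reals[OF this, of \<alpha>] show "cps_coeff f \<alpha> = cps_coeff g \<alpha>" by simp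
qed

lemma cps_eval_of_mpoly [simp]: "cps_eval (cps_of_mpoly p) w = mpoly_eval p w"
  unfolding mpoly_eval_def
  by (subst cps_eval_finite_support(1)[of "Poly_Mapping.keys p"])
    (auto simp: cps_coeff_of_mpoly in_keys_iff)

lemma mpoly_eval_single [simp]: "mpoly_eval (Poly_Mapping.single \<alpha> c) w = c * monom_eval \<alpha> w"
  by (cases "c = 0") (simp_all add: mpoly_eval_def)

lemma cps_eval_monom [simp]: "cps_eval (cps_monom \<alpha>) w = monom_eval \<alpha> w"
  by (simp add: cps_monom_def)

lemma cps_eval_var [simp]: "cps_eval (cps_var i) w = w $ i"
proof -
  have "monom_eval (Poly_Mapping.single i 1) w = (\<Prod>j\<in>UNIV. if i = j then w $ j else 1)"
    unfolding monom_eval_def by (intro prod.cong) (auto simp: lookup_single when_def)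
  then show ?thesis by (simp add: cps_var_def)
qed

section \<open>Series in \<open>x\<close> as series in \<open>x\<close> and \<open>z\<close>\<close>

definition x_part :: "'a ^ ('n option) \<Rightarrow> 'a ^ 'n::finite" where
  "x_part w = (\<chi> i. w $ Some i)"

lemma x_part_with_z [simp]: "x_part (with_z x z) = x" "with_z x z $ None = z"
  by (simp_all add: x_part_def with_z_def vec_eq_iff)

lemma x_part_nth [simp]: "x_part w $ i = w $ Some i"
  by (simp add: x_part_def)

lemma tendsto_x_part: "filterlim x_part (nhds 0) (nhds (0 :: 'a::real_normed_vector ^ ('n::finite option)))"
proof (rule vec_tendstoI)
  fix i
  show "((\<lambda>w. x_part w $ i) \<longlongrightarrow> (0 :: 'a ^ 'n) $ i) (nhds 0)"
    using tendsto_vec_nth[OF filterlim_ident, where a = "0 :: 'a ^ ('n option)" and i = "Some i"] by simp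
qed

lemma monom_eval_option:
  "monom_eval \<beta> w = w $ None ^ Poly_Mapping.lookup \<beta> None * monom_eval (Poly_Mapping.map_key Some \<beta>) (x_part w)"
  by (simp add: monom_eval_def UNIV_option_conv prod.reindex map_key.rep_eq)

lemma cps_eval_incl [simp]:
  fixes f :: "('n::finite, 'a::{real_normed_field, banach}) cps"
  shows "cps_eval (cps_incl f) w = cps_eval f (x_part w)"
proof -
  let ?S = "{\<beta> :: 'n option \<Rightarrow>\<^sub>0 nat. Poly_Mapping.lookup \<beta> None = 0}"
  let ?k = "Poly_Mapping.map_key (Some :: 'n \<Rightarrow> 'n option) :: _ \<Rightarrow> 'n \<Rightarrow>\<^sub>0 nat"
  define e where "e \<alpha> = Abs_poly_mapping (case_option 0 (Poly_Mapping.lookup \<alpha>))" for \<alpha> :: "'n \<Rightarrow>\<^sub>0 nat"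
  have e: "Poly_Mapping.lookup (e \<alpha>) = case_option 0 (Poly_Mapping.lookup \<alpha>)" for \<alpha>
    unfolding e_def by (rule lookup_Abs_poly_mapping) simp
  have bij: "bij_betw ?k ?S UNIV"
    by (rule bij_betw_byWitness[of _ e])
      (auto simp: poly_mapping_eq_iff fun_eq_iff e map_key.rep_eq split: option.split)
  have "cps_eval (cps_incl f) w = (\<Sum>\<^sub>\<infinity>\<beta>\<in>?S. cps_coeff f (?k \<beta>) * monom_eval (?k \<beta>) (x_part w))"
    unfolding cps_eval_def
    by (rule infsum_cong_neutral) (auto simp: cps_incl.rep_eq monom_eval_option[of _ w])
  also have "\<dots> = cps_eval f (x_part w)"
    unfolding cps_eval_def by (rule infsum_reindex_bij_betw[OF bij])
  finally show ?thesis .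
qed

lemma eventually_x_part:
  assumes "\<forall>\<^sub>F x in nhds 0. P x"
  shows "\<forall>\<^sub>F w in nhds (0 :: 'a::real_normed_vector ^ ('n::finite option)). P (x_part w)"
  using tendsto_x_part assms by (auto simp: filterlim_iff)

lemma cps_incl_sum: "cps_incl (sum f A) = (\<Sum>a\<in>A. cps_incl (f a))"
  by (rule cps_eqI) (simp add: cps_incl.rep_eq)

lemma cps_incl_minus: "cps_incl (- f) = - cps_incl f"
  by (rule cps_eqI) (simp add: cps_incl.rep_eq)

lemma cps_incl_times: "cps_incl (f * g) = cps_incl f * cps_incl g"
proof (rule cps_eqI_eval)
  show "\<forall>\<^sub>F w in nhds 0. cps_eval (cps_incl (f * g)) w = cps_eval (cps_incl f * cps_incl g) w"
    using eventually_x_part[OF eventually_cps_eval_times[of f g]]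
      eventually_cps_eval_times[of "cps_incl f" "cps_incl g"]
    by eventually_elim simp
qed

lemma cps_eval_1 [simp]: "cps_eval 1 w = 1"
proof -
  have "1 = cps_of_mpoly (Poly_Mapping.single 0 1)"
    by (rule cps_eqI) (simp add: cps_coeff_of_mpoly one_cps.rep_eq lookup_one when_def)
  then have "cps_eval 1 w = mpoly_eval (Poly_Mapping.single 0 1) w"
    using cps_eval_of_mpoly by metis
  also have "\<dots> = 1" unfolding mpoly_eval_single by (simp add: monom_eval_def)
  finally show ?thesis .
qed

lemma cps_incl_1: "cps_incl 1 = 1"
  by (rule cps_eqI_eval) simp

lemma cps_incl_power: "cps_incl (f ^ k) = cps_incl f ^ k"
  by (induction k) (simp_all add: cps_incl_1 cps_incl_times)

lemma eventually_cps_eval_power: "\<forall>\<^sub>F w in nhds 0. cps_eval (f ^ k) w = cps_eval f w ^ k"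
proof (induction k)
  case (Suc k)
  then show ?case using eventually_cps_eval_times[of f "f ^ k"] by eventually_elim simp
qed simp

lemma cps_monom_option:
  "cps_monom \<beta> = cps_var None ^ Poly_Mapping.lookup \<beta> None * cps_incl (cps_monom (Poly_Mapping.map_key Some \<beta>))"
  (is "_ = ?a * ?b")
proof (rule cps_eqI_eval)
  show "\<forall>\<^sub>F w in nhds 0. cps_eval (cps_monom \<beta>) w = cps_eval (?a * ?b) w"
    using eventually_cps_eval_times[of ?a ?b]
      eventually_cps_eval_power[of "cps_var None" "Poly_Mapping.lookup \<beta> None"]
    by eventually_elim (simp add: monom_eval_option[of \<beta>])
qed

section \<open>Reduction modulo the ideal of the truncated graph\<close>

lemma mdeg_eq_0_iff [simp]: "mdeg \<alpha> = 0 \<longleftrightarrow> \<alpha> = 0"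
  by (auto simp: mdeg_def poly_mapping_eq_iff fun_eq_iff)

lemma mdeg_single [simp]: "mdeg (Poly_Mapping.single i n) = n"
  by (simp add: mdeg_def lookup_single when_def)

lemma cps_times_coeff_zero:
  assumes "\<And>\<alpha>. mdeg \<alpha> < M \<Longrightarrow> cps_coeff f \<alpha> = 0" "\<And>\<alpha>. mdeg \<alpha> < K \<Longrightarrow> cps_coeff g \<alpha> = 0"
    and "mdeg \<alpha> < M + K"
  shows "cps_coeff (f * g) \<alpha> = 0"
  unfolding cps_coeff_times
proof (rule sum.neutral, clarify)
  fix \<beta> \<gamma> assume "\<alpha> = \<beta> + \<gamma>"
  then have "mdeg \<beta> < M \<or> mdeg \<gamma> < K" using assms(3) by (auto simp: mdeg_add)
  then show "cps_coeff f \<beta> * cps_coeff g \<gamma> = 0" using assms(1,2) by auto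
qed

lemma cps_power_coeff_zero:
  assumes "cps_coeff f 0 = 0" "mdeg \<alpha> < k"
  shows "cps_coeff (f ^ k) \<alpha> = 0"
  using assms(2)
proof (induction k arbitrary: \<alpha>)
  case (Suc k)
  then show ?case
    unfolding power_Suc using assms(1) by (intro cps_times_coeff_zero[of 1 f k]) auto
qed simp

lemma cps_coeff_monom_times:
  "cps_coeff (cps_monom \<beta> * g) (\<beta> + \<gamma>) = cps_coeff g \<gamma>"
  "(\<And>\<gamma>. \<alpha> \<noteq> \<beta> + \<gamma>) \<Longrightarrow> cps_coeff (cps_monom \<beta> * g) \<alpha> = 0"
proof -
  have coeff: "cps_coeff (cps_monom \<beta>) \<delta> = (if \<delta> = \<beta> then 1 else 0)" for \<delta>
    by (simp add: cps_monom_def cps_coeff_of_mpoly lookup_single when_def)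
  have "cps_coeff (cps_monom \<beta> * g) (\<beta> + \<gamma>)
      = (\<Sum>(\<beta>', \<gamma>')\<in>{(\<beta>, \<gamma>)}. cps_coeff (cps_monom \<beta>) \<beta>' * cps_coeff g \<gamma>')"
    unfolding cps_coeff_times by (rule sum.mono_neutral_right) (auto simp: finite_add_decomp coeff split: if_splits)
  then show "cps_coeff (cps_monom \<beta> * g) (\<beta> + \<gamma>) = cps_coeff g \<gamma>" by (simp add: coeff)
  show "cps_coeff (cps_monom \<beta> * g) \<alpha> = 0" if "\<And>\<gamma>. \<alpha> \<noteq> \<beta> + \<gamma>"
    unfolding cps_coeff_times by (rule sum.neutral) (use that in \<open>auto simp: coeff\<close>)
qed

lemma mdeg_split:
  assumes "M \<le> mdeg \<alpha>"
  shows "\<exists>\<beta> \<gamma>. \<alpha> = \<beta> + \<gamma> \<and> mdeg \<beta> = M"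
  using assms
proof (induction M)
  case 0
  then show ?case by (intro exI[of _ 0] exI[of _ \<alpha>]) simp
next
  case (Suc M)
  then obtain \<beta> \<gamma> where *: "\<alpha> = \<beta> + \<gamma>" "mdeg \<beta> = M" by auto
  then have "\<gamma> \<noteq> 0" using Suc.prems by auto
  then obtain i where i: "Poly_Mapping.lookup \<gamma> i \<noteq> 0"
    by (auto simp: poly_mapping_eq_iff fun_eq_iff)
  let ?e = "Poly_Mapping.single i (1 :: nat)"
  have "\<gamma> = ?e + (\<gamma> - ?e)"
    using i by (auto simp: poly_mapping_eq_iff fun_eq_iff lookup_add lookup_minus lookup_single when_def)
  then show ?case
    using * by (intro exI[of _ "\<beta> + ?e"] exI[of _ "\<gamma> - ?e"]) (simp add: mdeg_add add.assoc)
qed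

lemma convergent_coeffs_shift:
  fixes c :: "('v::finite \<Rightarrow>\<^sub>0 nat) \<Rightarrow> 'a::{real_normed_field, banach}"
  assumes "convergent_coeffs c"
  shows "convergent_coeffs (\<lambda>\<gamma>. c (\<beta> + \<gamma>))"
proof -
  obtain r where r: "r > 0" "(\<lambda>\<alpha>. norm (c \<alpha>) * r ^ mdeg \<alpha>) summable_on UNIV"
    using assms by (auto simp: convergent_coeffs_iff)
  have "(\<lambda>\<alpha>. norm (c \<alpha>) * r ^ mdeg \<alpha>) summable_on range (\<lambda>\<gamma>. \<beta> + \<gamma>)"
    using r(2) by (rule summable_on_subset_banach) simp
  then have "(\<lambda>\<gamma>. norm (c (\<beta> + \<gamma>)) * r ^ mdeg (\<beta> + \<gamma>)) summable_on UNIV"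
    by (subst (asm) summable_on_reindex) (auto simp: inj_def o_def)
  then have "(\<lambda>\<gamma>. (1 / r ^ mdeg \<beta>) * (norm (c (\<beta> + \<gamma>)) * r ^ mdeg (\<beta> + \<gamma>))) summable_on UNIV"
    by (rule summable_on_cmult_right)
  then have "(\<lambda>\<gamma>. norm (c (\<beta> + \<gamma>)) * r ^ mdeg \<gamma>) summable_on UNIV"
    using r(1) by (simp add: mdeg_add power_add)
  then show ?thesis using r(1) by (auto simp: convergent_coeffs_iff)
qed

text \<open>Each exponent of degree at least \<open>M\<close> is assigned to one of the monomials \<open>\<pi> \<alpha>\<close> of degree \<open>M\<close> dividing
  it; \<open>g \<beta>\<close> collects the terms assigned to \<open>\<beta>\<close>, divided by \<open>x\<^sup>\<beta>\<close>.\<close>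

lemma cps_high_order_monom_expansion:
  fixes f :: "('v::finite, 'a::{real_normed_field, banach}) cps"
  assumes "\<And>\<alpha>. mdeg \<alpha> < M \<Longrightarrow> cps_coeff f \<alpha> = 0"
  shows "\<exists>g. f = (\<Sum>\<beta> | mdeg \<beta> = M. cps_monom \<beta> * g \<beta>)"
proof -
  have "\<forall>\<alpha>. \<exists>\<beta>. M \<le> mdeg \<alpha> \<longrightarrow> mdeg \<beta> = M \<and> (\<exists>\<gamma>. \<alpha> = \<beta> + \<gamma>)"
    using mdeg_split by metis
  then obtain \<pi> :: "('v \<Rightarrow>\<^sub>0 nat) \<Rightarrow> 'v \<Rightarrow>\<^sub>0 nat"
    where \<pi>: "\<And>\<alpha>. M \<le> mdeg \<alpha> \<Longrightarrow> mdeg (\<pi> \<alpha>) = M \<and> (\<exists>\<gamma>. \<alpha> = \<pi> \<alpha> + \<gamma>)"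
    by metis
  define c where "c \<beta> \<gamma> = (if \<pi> (\<beta> + \<gamma>) = \<beta> then cps_coeff f (\<beta> + \<gamma>) else 0)" for \<beta> \<gamma>
  define g where "g \<beta> = Abs_cps (c \<beta>)" for \<beta>
  have "convergent_coeffs (c \<beta>)" for \<beta>
    by (rule convergent_coeffs_mono[OF convergent_coeffs_shift[of "cps_coeff f" \<beta>]])
      (use cps_coeff in \<open>auto simp: c_def\<close>)
  then have g: "cps_coeff (g \<beta>) = c \<beta>" for \<beta> by (simp add: g_def Abs_cps_inverse)
  have coeff: "cps_coeff (cps_monom \<beta> * g \<beta>) \<alpha> = (if \<beta> = \<pi> \<alpha> then cps_coeff f \<alpha> else 0)"
    if "M \<le> mdeg \<alpha>" for \<alpha> \<beta>
  proof (cases "\<exists>\<gamma>. \<alpha> = \<beta> + \<gamma>")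
    case True
    then show ?thesis by (auto simp: cps_coeff_monom_times g c_def)
  next
    case False
    then show ?thesis using \<pi>[OF that] by (auto simp: cps_coeff_monom_times(2))
  qed
  have "f = (\<Sum>\<beta> | mdeg \<beta> = M. cps_monom \<beta> * g \<beta>)"
  proof (rule cps_eqI)
    fix \<alpha>
    show "cps_coeff f \<alpha> = cps_coeff (\<Sum>\<beta> | mdeg \<beta> = M. cps_monom \<beta> * g \<beta>) \<alpha>"
    proof (cases "M \<le> mdeg \<alpha>")
      case True
      then show ?thesis using \<pi>[OF True] by (simp add: coeff sum.delta finite_mdeg)
    next
      case False
      have "cps_coeff (cps_monom \<beta> * g \<beta>) \<alpha> = 0" if "mdeg \<beta> = M" for \<beta>
        by (rule cps_coeff_monom_times(2)) (use False that in \<open>auto simp: mdeg_add\<close>)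
      then show ?thesis using False assms by simp
    qed
  qed
  then show ?thesis by blast
qed

lemma ideal_generated_by_superset: "x \<in> S \<Longrightarrow> x \<in> ideal_generated_by S"
  unfolding ideal_generated_by_def by (rule module.span_base[OF module_self])

lemma ideal_generated_by_mult: "x \<in> ideal_generated_by S \<Longrightarrow> r * x \<in> ideal_generated_by S"
  unfolding ideal_generated_by_def by (rule module.span_scale[OF module_self])

lemma ideal_generated_by_add:
  "x \<in> ideal_generated_by S \<Longrightarrow> y \<in> ideal_generated_by S \<Longrightarrow> x + y \<in> ideal_generated_by S"
  unfolding ideal_generated_by_def by (rule module.span_add[OF module_self])

lemma ideal_generated_by_sum:
  "(\<And>a. a \<in> A \<Longrightarrow> f a \<in> ideal_generated_by S) \<Longrightarrow> sum f A \<in> ideal_generated_by S"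
  unfolding ideal_generated_by_def by (rule module.span_sum[OF module_self])

lemma ideal_generated_by_power_diff:
  assumes "a - b \<in> ideal_generated_by S"
  shows "a ^ k - b ^ k \<in> ideal_generated_by S"
  unfolding power_diff_sumr2 mult.commute[of "a - b"] by (rule ideal_generated_by_mult[OF assms])

text \<open>If \<open>q\<close> has no constant term, a germ belongs to this ideal iff its restriction to the graph
  \<open>z = -q(x)\<close>, as a series in \<open>x\<close>, vanishes to order \<open>N\<close>.\<close>

definition graph_ideal ::
    "nat \<Rightarrow> ('n::finite, 'a::{real_normed_field, banach}) cps \<Rightarrow> ('n option, 'a) cps set" where
  "graph_ideal N q = ideal_generated_by
    (insert (cps_var None + cps_incl q) {cps_incl (cps_monom \<alpha>) | \<alpha>. mdeg \<alpha> = N})"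

lemma cps_incl_in_graph_ideal:
  assumes "\<And>\<alpha>. mdeg \<alpha> < N \<Longrightarrow> cps_coeff h \<alpha> = 0"
  shows "cps_incl h \<in> graph_ideal N q"
proof -
  obtain g where g: "h = (\<Sum>\<beta> | mdeg \<beta> = N. cps_monom \<beta> * g \<beta>)"
    using cps_high_order_monom_expansion[of N h] assms by blast
  have "cps_incl h = (\<Sum>\<beta> | mdeg \<beta> = N. cps_incl (g \<beta>) * cps_incl (cps_monom \<beta>))"
    by (subst g) (simp add: cps_incl_sum cps_incl_times mult.commute)
  also have "\<dots> \<in> graph_ideal N q"
    unfolding graph_ideal_def
    by (intro ideal_generated_by_sum ideal_generated_by_mult ideal_generated_by_superset) auto
  finally show ?thesis .
qed

lemma z_power_cong_mod_graph_ideal: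
  "cps_var None ^ k * cps_incl g - cps_incl ((- q) ^ k * g) \<in> graph_ideal N q"
proof -
  have "cps_var None - (- cps_incl q) \<in> graph_ideal N q"
    unfolding graph_ideal_def by (rule ideal_generated_by_superset) simp
  then have "cps_incl g * (cps_var None ^ k - (- cps_incl q) ^ k) \<in> graph_ideal N q"
    unfolding graph_ideal_def by (intro ideal_generated_by_mult ideal_generated_by_power_diff)
  then show ?thesis
    by (simp add: cps_incl_times cps_incl_power cps_incl_minus algebra_simps)
qed

text \<open>Replacing \<open>z\<close> by \<open>-q\<close>, which has no constant term, does not lower the order of vanishing.\<close>

lemma cps_monom_in_graph_ideal:
  fixes q :: "('n::finite, 'a::{real_normed_field, banach}) cps"
  assumes q: "cps_coeff q 0 = 0" and \<beta>: "mdeg \<beta> = N"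
  shows "cps_monom \<beta> \<in> graph_ideal N q"
proof -
  define k where "k = Poly_Mapping.lookup \<beta> None"
  define \<alpha> where "\<alpha> = Poly_Mapping.map_key Some \<beta>"
  have N: "N = k + mdeg \<alpha>"
    using \<beta> by (simp add: k_def \<alpha>_def mdeg_def UNIV_option_conv sum.reindex map_key.rep_eq)
  have "cps_incl ((- q) ^ k * cps_monom \<alpha>) \<in> graph_ideal N q"
  proof (rule cps_incl_in_graph_ideal)
    fix \<delta> :: "'n \<Rightarrow>\<^sub>0 nat" assume \<delta>: "mdeg \<delta> < N"
    show "cps_coeff ((- q) ^ k * cps_monom \<alpha>) \<delta> = 0"
    proof (rule cps_times_coeff_zero)
      show "mdeg \<delta> < k + mdeg \<alpha>" using \<delta> N by simp
      show "cps_coeff ((- q) ^ k) \<gamma> = 0" if "mdeg \<gamma> < k" for \<gamma>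
        using that q by (intro cps_power_coeff_zero) auto
      show "cps_coeff (cps_monom \<alpha>) \<gamma> = 0" if "mdeg \<gamma> < mdeg \<alpha>" for \<gamma>
        using that by (auto simp: cps_monom_def cps_coeff_of_mpoly lookup_single when_def)
    qed
  qed
  then have "(cps_var None ^ k * cps_incl (cps_monom \<alpha>) - cps_incl ((- q) ^ k * cps_monom \<alpha>))
      + cps_incl ((- q) ^ k * cps_monom \<alpha>) \<in> graph_ideal N q"
    using z_power_cong_mod_graph_ideal unfolding graph_ideal_def by (intro ideal_generated_by_add)
  then show ?thesis by (simp add: cps_monom_option[of \<beta>] k_def \<alpha>_def)
qed

text \<open>The terms of degree at least \<open>N\<close> lie in the ideal; in each of the finitely many remaining terms \<open>z\<close>
  is replaced by \<open>-q\<close>.\<close>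

lemma reduce_mod_graph_ideal:
  fixes q :: "('n::finite, 'a::{real_normed_field, banach}) cps"
  assumes q: "cps_coeff q 0 = 0"
  shows "\<exists>h. f - cps_incl h \<in> graph_ideal N q"
proof -
  let ?F = "\<Union>j<N. {\<beta> :: 'n option \<Rightarrow>\<^sub>0 nat. mdeg \<beta> = j}"
  let ?k = "\<lambda>\<beta>. Poly_Mapping.lookup \<beta> None" and ?m = "\<lambda>\<beta>. Poly_Mapping.map_key Some \<beta>"
  define C :: "'a \<Rightarrow> ('n, 'a) cps" where "C = (\<lambda>c. cps_of_mpoly (Poly_Mapping.single 0 c))"
  define g where "g \<beta> = cps_monom (?m \<beta>) * C (cps_coeff f \<beta>)" for \<beta>
  define R where "R = f - (\<Sum>\<beta>\<in>?F. cps_monom \<beta> * cps_incl (C (cps_coeff f \<beta>)))"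
  define h where "h = (\<Sum>\<beta>\<in>?F. (- q) ^ ?k \<beta> * g \<beta>)"
  have C: "cps_incl (C c) = cps_of_mpoly (Poly_Mapping.single 0 c)" for c
    by (rule cps_eqI_eval) (simp add: C_def monom_eval_def)
  have "cps_coeff (cps_monom \<beta> * cps_incl (C c)) \<alpha> = (if \<alpha> = \<beta> then c else 0)" for \<alpha> \<beta> c
  proof (cases "\<exists>\<gamma>. \<alpha> = \<beta> + \<gamma>")
    case True
    then obtain \<gamma> where "\<alpha> = \<beta> + \<gamma>" by blast
    then show ?thesis
      by (simp add: C cps_coeff_monom_times(1) cps_coeff_of_mpoly lookup_single when_def eq_commute[of 0])
  next
    case False
    then have "\<alpha> \<noteq> \<beta>" using add_0_right[of \<beta>] by metis
    with False show ?thesis by (simp add: cps_coeff_monom_times(2))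
  qed
  then have "cps_coeff R \<alpha> = 0" if "mdeg \<alpha> < N" for \<alpha>
    using that by (simp add: R_def finite_mdeg)
  then obtain G where G: "R = (\<Sum>\<beta> | mdeg \<beta> = N. cps_monom \<beta> * G \<beta>)"
    using cps_high_order_monom_expansion[of N R] by blast
  have R: "R \<in> graph_ideal N q"
    unfolding G mult.commute[of "cps_monom _"] using cps_monom_in_graph_ideal[OF q]
    unfolding graph_ideal_def by (intro ideal_generated_by_sum ideal_generated_by_mult) auto
  have monom: "cps_monom \<beta> = cps_var None ^ ?k \<beta> * cps_incl (cps_monom (?m \<beta>))"
    for \<beta> :: "'n option \<Rightarrow>\<^sub>0 nat" by (rule cps_monom_option)
  have "f - cps_incl h = R + (\<Sum>\<beta>\<in>?F. cps_var None ^ ?k \<beta> * cps_incl (g \<beta>) - cps_incl ((- q) ^ ?k \<beta> * g \<beta>))"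
    unfolding sum_subtractf h_def cps_incl_sum
    by (simp add: R_def g_def cps_incl_times monom mult.assoc)
  also have "\<dots> \<in> graph_ideal N q"
    using R z_power_cong_mod_graph_ideal unfolding graph_ideal_def
    by (intro ideal_generated_by_add ideal_generated_by_sum)
  finally show ?thesis by blast
qed

section \<open>Germs of functions on the product of half planes\<close>

lemma eventually_cps_eval_isCont:
  fixes f :: "('v::finite, 'a::{real_normed_field, banach}) cps"
  shows "\<forall>\<^sub>F w in nhds 0. isCont (cps_eval f) w"
proof -
  obtain C r where Cr: "C \<ge> 0" "r > 0"
    "\<forall>\<rho> w v. 0 < \<rho> \<longrightarrow> \<rho> \<le> r \<longrightarrow> (\<forall>i. norm (w $ i) \<le> \<rho>) \<longrightarrow> (\<forall>i. norm (v $ i) \<le> \<rho>) \<longrightarrow>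
      norm (cps_eval f w - cps_eval f v) \<le> C * \<rho> ^ 0 * (\<Sum>i\<in>UNIV. norm (w $ i - v $ i))"
    by (rule cps_Lipschitz[of 0 f]) simp
  have "isCont (cps_eval f) v" if v: "v \<in> polydisc r" for v
  proof -
    have "\<forall>\<^sub>F w in at v. w \<in> polydisc r"
      using v by (intro eventually_at_in_open' polydisc_open)
    then have "\<forall>\<^sub>F w in at v. norm (cps_eval f w - cps_eval f v) \<le> C * (\<Sum>i\<in>UNIV. norm (w $ i - v $ i))"
    proof eventually_elim
      case (elim w)
      then show ?case
        using Cr(3)[rule_format, of r w v] Cr(2) v by (auto simp: polydisc_def intro: less_imp_le)
    qed
    moreover have "((\<lambda>w. C * (\<Sum>i\<in>UNIV. norm (w $ i - v $ i))) \<longlongrightarrow> 0) (at v)"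
      by (auto intro!: tendsto_eq_intros)
    ultimately have "((\<lambda>w. cps_eval f w - cps_eval f v) \<longlongrightarrow> 0) (at v)"
      by (rule Lim_null_comparison)
    then show ?thesis unfolding isCont_def by (rule LIM_zero_cancel)
  qed
  then show ?thesis unfolding eventually_nhds_0_iff_polydisc using Cr(2) by blast
qed

lemma tendsto_cps_eval_nhds_0: "filterlim (cps_eval f) (nhds (cps_eval f 0)) (nhds 0)"
  using eventually_nhds_x_imp_x[OF eventually_cps_eval_isCont[of f]]
  by (simp add: isCont_def tendsto_at_iff_tendsto_nhds)

lemma tendsto_with_z:
  assumes "filterlim f (nhds 0) F" "filterlim g (nhds 0) F"
  shows "filterlim (\<lambda>x. with_z (f x) (g x)) (nhds (0 :: 'a::real_normed_vector ^ ('n::finite option))) F"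
proof (rule vec_tendstoI)
  fix i
  show "((\<lambda>x. with_z (f x) (g x) $ i) \<longlongrightarrow> (0 :: 'a ^ ('n option)) $ i) F"
    using assms(2) tendsto_vec_nth[OF assms(1)] by (cases i) (simp_all add: with_z_def)
qed

text \<open>Every point of the closure is approached from inside along the direction \<open>(\<i>, \<dots>, \<i>)\<close>.\<close>

lemma nonneg_on_closed_halfplane:
  fixes F :: "complex ^ 'v::finite \<Rightarrow> real"
  assumes "isCont F w" "open S" "w \<in> S" "\<And>v. v \<in> S \<Longrightarrow> v \<in> poly_halfplane \<Longrightarrow> F v \<ge> 0"
    and Im: "\<And>i. Im (w $ i) \<ge> 0"
  shows "F w \<ge> 0"
proof -
  define s where "s t = w + t *\<^sub>R (\<chi> i. \<i>)" for t
  have lim: "(s \<longlongrightarrow> w) (at_right 0)"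
    unfolding s_def by (auto intro!: tendsto_eq_intros)
  have "\<forall>\<^sub>F t in at_right 0. F (s t) \<ge> 0"
    using topological_tendstoD[OF lim assms(2,3)] eventually_at_right_less[of 0]
  proof eventually_elim
    case (elim t)
    have "s t \<in> poly_halfplane"
      using elim(2) Im by (auto simp: poly_halfplane_def s_def intro: add_nonneg_pos)
    then show ?case using assms(4) elim(1) by blast
  qed
  with isCont_tendsto_compose[OF assms(1) lim] show ?thesis
    by (rule tendsto_lowerbound) simp
qed

lemma eventually_nonneg_on_closed_halfplane:
  fixes F :: "complex ^ 'v::finite \<Rightarrow> real"
  assumes "\<forall>\<^sub>F w in nhds 0. isCont F w" "\<forall>\<^sub>F w in nhds 0. w \<in> poly_halfplane \<longrightarrow> F w \<ge> 0"
  shows "\<forall>\<^sub>F w in nhds 0. (\<forall>i. Im (w $ i) \<ge> 0) \<longrightarrow> F w \<ge> 0"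
proof -
  obtain S where S: "open S" "0 \<in> S" "\<And>w. w \<in> S \<Longrightarrow> w \<in> poly_halfplane \<longrightarrow> F w \<ge> 0"
    using assms(2) by (auto simp: eventually_nhds)
  have "\<forall>\<^sub>F w in nhds 0. w \<in> S" using S by (auto simp: eventually_nhds)
  with assms(1) show ?thesis
  proof eventually_elim
    case (elim w)
    then show ?case using nonneg_on_closed_halfplane[where F = F and w = w and S = S] S by blast
  qed
qed

text \<open>In this form the condition speaks of germs at \<open>0\<close> and involves no quotient.\<close>

lemma admissible_numerators_iff:
  assumes "\<forall>w \<in> poly_halfplane. mpoly_eval p w \<noteq> 0"
  shows "q \<in> admissible_numerators p \<longleftrightarrow>
    (\<exists>C. \<forall>\<^sub>F w in nhds 0. w \<in> poly_halfplane \<longrightarrow> norm (cps_eval q w) \<le> C * norm (mpoly_eval p w))"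
proof -
  have "norm (cps_eval q w / mpoly_eval p w) \<le> C \<longleftrightarrow> norm (cps_eval q w) \<le> C * norm (mpoly_eval p w)"
    if "w \<in> poly_halfplane" for C w
    using assms that by (simp add: norm_divide divide_le_eq)
  then have "(\<forall>w\<in>poly_halfplane \<inter> polydisc \<epsilon>. norm (cps_eval q w / mpoly_eval p w) \<le> C) \<longleftrightarrow>
      (\<forall>w\<in>polydisc \<epsilon>. w \<in> poly_halfplane \<longrightarrow> norm (cps_eval q w) \<le> C * norm (mpoly_eval p w))" for \<epsilon> C
    by blast
  then show ?thesis
    unfolding admissible_numerators_def eventually_nhds_0_iff_polydisc bounded_iff mem_Collect_eq
      ball_simps by blast
qed

lemma admissible_numerators_subspace:
  assumes p: "\<forall>w \<in> poly_halfplane. mpoly_eval p w \<noteq> 0"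
  shows "module.subspace (*) (admissible_numerators p)"
proof (rule module.subspaceI[OF module_self])
  show "0 \<in> admissible_numerators p"
    unfolding admissible_numerators_iff[OF p]
    by (intro exI[of _ 0] always_eventually) (simp add: cps_eval_def)
next
  fix f g assume "f \<in> admissible_numerators p" "g \<in> admissible_numerators p"
  then obtain C D
    where C: "\<forall>\<^sub>F w in nhds 0. w \<in> poly_halfplane \<longrightarrow> norm (cps_eval f w) \<le> C * norm (mpoly_eval p w)"
      and D: "\<forall>\<^sub>F w in nhds 0. w \<in> poly_halfplane \<longrightarrow> norm (cps_eval g w) \<le> D * norm (mpoly_eval p w)"
    by (auto simp: admissible_numerators_iff[OF p])
  have "\<forall>\<^sub>F w in nhds 0. w \<in> poly_halfplane \<longrightarrow>
      norm (cps_eval (f + g) w) \<le> (C + D) * norm (mpoly_eval p w)"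
    using C D eventually_cps_eval_add[of f g]
    by eventually_elim (auto simp: distrib_right intro: norm_triangle_le)
  then show "f + g \<in> admissible_numerators p" by (auto simp: admissible_numerators_iff[OF p])
next
  fix r f :: "('a, complex) cps" assume "f \<in> admissible_numerators p"
  then obtain C
    where C: "\<forall>\<^sub>F w in nhds 0. w \<in> poly_halfplane \<longrightarrow> norm (cps_eval f w) \<le> C * norm (mpoly_eval p w)"
    by (auto simp: admissible_numerators_iff[OF p])
  obtain D where D: "\<forall>\<^sub>F w in nhds 0. norm (cps_eval r w) \<le> D * norm w ^ 0"
    using cps_order_bound[of 0 r] by blast
  have "\<forall>\<^sub>F w in nhds 0. w \<in> poly_halfplane \<longrightarrow>
      norm (cps_eval (r * f) w) \<le> (D * C) * norm (mpoly_eval p w)"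
    using C D eventually_cps_eval_times[of r f]
  proof eventually_elim
    case (elim w)
    have "D \<ge> 0" using order_trans[OF norm_ge_zero elim(2)] by simp
    then show ?case
      using elim by (auto simp: norm_mult mult.assoc intro!: mult_mono)
  qed
  then show "r * f \<in> admissible_numerators p" by (auto simp: admissible_numerators_iff[OF p])
qed

lemma vec_of_real_real [simp]: "vec_of_real x = (x :: real ^ 'v::finite)"
  by (simp add: vec_eq_iff)

lemma monom_eval_vec_of_real:
  "monom_eval \<alpha> (vec_of_real x) = (of_real (monom_eval \<alpha> x) :: 'a::real_normed_field)"
  by (simp add: monom_eval_def)

lemma Im_cps_eval_vec_of_real:
  assumes "cps_summable_at f (vec_of_real x)"
  shows "Im (cps_eval f (vec_of_real x)) = cps_eval (cps_Im f) x"
proof -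
  have "Im (cps_eval f (vec_of_real x)) = (\<Sum>\<^sub>\<infinity>\<alpha>. Im (cps_coeff f \<alpha> * monom_eval \<alpha> (vec_of_real x)))"
    unfolding cps_eval_def by (rule infsum_Im[symmetric]) (rule abs_summable_summable[OF assms])
  then show ?thesis by (simp add: cps_eval_def monom_eval_vec_of_real)
qed

lemma eventually_vec_of_real:
  assumes "\<forall>\<^sub>F w in nhds (0 :: 'a::real_normed_field ^ 'v::finite). P w"
  shows "\<forall>\<^sub>F x in nhds 0. P (vec_of_real x)"
  using tendsto_vec_of_real assms by (auto simp: filterlim_iff)

lemma eventually_Im_cps_eval_vec_of_real:
  "\<forall>\<^sub>F x in nhds 0. Im (cps_eval f (vec_of_real x)) = cps_eval (cps_Im f) x"
  using eventually_vec_of_real[OF eventually_cps_summable_at[of f]]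
  by eventually_elim (rule Im_cps_eval_vec_of_real)

lemma cps_hom_part_Im: "cps_hom_part j (cps_Im f) = cps_Im (cps_hom_part j f)"
  by (rule cps_eqI) simp

section \<open>Consequences of the absence of zeros\<close>

text \<open>Otherwise \<open>(x, -\<phi>(x))\<close> would be a zero of \<open>p\<close> with all imaginary parts positive.\<close>

lemma eventually_graph_in_lower_halfplane:
  fixes \<phi> :: "('n::finite, complex) cps"
  assumes no_zeros: "\<forall>w \<in> poly_halfplane. mpoly_eval p w \<noteq> 0"
    and fact: "\<forall>\<^sub>F w in nhds 0. mpoly_eval p w = cps_eval u w * (w $ None + cps_eval \<phi> (x_part w))"
    and \<phi>_0: "cps_eval \<phi> 0 = 0"
  shows "\<forall>\<^sub>F x in nhds 0. (\<forall>i. Im (x $ i) \<ge> 0) \<longrightarrow> Im (cps_eval \<phi> x) \<ge> 0"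
proof (rule eventually_nonneg_on_closed_halfplane)
  show "\<forall>\<^sub>F x in nhds 0. isCont (\<lambda>x. Im (cps_eval \<phi> x)) x"
    using eventually_cps_eval_isCont[of \<phi>] by eventually_elim (auto simp: isCont_def intro: tendsto_Im)
  have "filterlim (\<lambda>x. with_z x (- cps_eval \<phi> x)) (nhds 0) (nhds 0)"
    using tendsto_minus[OF tendsto_cps_eval_nhds_0[of \<phi>]] \<phi>_0
    by (intro tendsto_with_z filterlim_ident) simp
  from filterlim_iff[THEN iffD1, OF this, rule_format, OF fact]
  have "\<forall>\<^sub>F x in nhds 0. mpoly_eval p (with_z x (- cps_eval \<phi> x)) = 0"
    by eventually_elim simp
  then show "\<forall>\<^sub>F x in nhds 0. x \<in> poly_halfplane \<longrightarrow> Im (cps_eval \<phi> x) \<ge> 0"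
  proof eventually_elim
    case (elim x)
    show ?case
    proof (rule impI, rule ccontr)
      assume "x \<in> poly_halfplane" "\<not> Im (cps_eval \<phi> x) \<ge> 0"
      then have "with_z x (- cps_eval \<phi> x) \<in> poly_halfplane"
        by (auto simp: poly_halfplane_def with_z_def split: option.split)
      then show False using no_zeros elim by blast
    qed
  qed
qed

text \<open>On real points \<open>Im \<phi>\<close> is nonnegative, so its leading form is nonnegative too; a form of odd degree
  changes sign under \<open>x \<mapsto> -x\<close> and would have to vanish.\<close>

lemma first_nonreal_degree_even:
  fixes \<phi> :: "('n::finite, complex) cps"
  assumes nonneg: "\<forall>\<^sub>F x in nhds 0. (\<forall>i. Im (x $ i) \<ge> 0) \<longrightarrow> Im (cps_eval \<phi> x) \<ge> 0"
    and lower: "\<And>j. j < N \<Longrightarrow> cps_Im (cps_hom_part j \<phi>) = 0"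
    and N: "cps_Im (cps_hom_part N \<phi>) \<noteq> 0"
  shows "even N"
proof (rule ccontr)
  assume odd: "odd N"
  let ?G = "cps_eval (cps_hom_part N (cps_Im \<phi>))"
  have real_nonneg: "\<forall>\<^sub>F x in nhds 0. cps_eval (cps_Im \<phi>) x \<ge> 0"
    using eventually_Im_cps_eval_vec_of_real[of \<phi>] eventually_vec_of_real[OF nonneg]
    by eventually_elim simp
  have G: "?G x \<ge> 0" for x
  proof (rule tendsto_lowerbound)
    have "((\<lambda>t. cps_eval (cps_Im \<phi>) (t *\<^sub>R x) / of_real t ^ N) \<longlongrightarrow> ?G x) (at 0)"
      by (rule cps_leading_term_on_line) (simp add: cps_hom_part_Im lower, simp add: cps_eval_def)
    then show "((\<lambda>t. cps_eval (cps_Im \<phi>) (t *\<^sub>R x) / t ^ N) \<longlongrightarrow> ?G x) (at_right 0)"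
      by (auto intro: tendsto_within_subset)
    have "filterlim (\<lambda>t. t *\<^sub>R x) (nhds 0) (at_right 0)"
      by (auto intro!: tendsto_eq_intros)
    from filterlim_iff[THEN iffD1, OF this, rule_format, OF real_nonneg] eventually_at_right_less[of 0]
    show "\<forall>\<^sub>F t in at_right 0. 0 \<le> cps_eval (cps_Im \<phi>) (t *\<^sub>R x) / t ^ N"
      by eventually_elim simp
  qed simp
  have "?G x = 0" for x
  proof -
    have "?G (- 1 *s x) = - ?G x"
      unfolding cps_eval_hom_part_scale using odd by simp
    then show ?thesis using G[of x] G[of "- 1 *s x"] by simp
  qed
  then have "cps_coeff (cps_Im \<phi>) \<alpha> = 0" if "mdeg \<alpha> = N" for \<alpha>
    using that by (intro cps_hom_part_zero_if_zero_on_reals[of N]) simp_all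
  then have "cps_Im (cps_hom_part N \<phi>) = 0"
    by (intro cps_eqI) simp
  then show False using N by contradiction
qed

lemma cps_eval_hom_part_1:
  fixes f :: "('v::finite, 'a::{real_normed_field, banach}) cps"
  shows "cps_eval (cps_hom_part 1 f) w = (\<Sum>i\<in>UNIV. cps_coeff f (Poly_Mapping.single i 1) * w $ i)"
proof -
  have "{\<alpha> :: 'v \<Rightarrow>\<^sub>0 nat. mdeg \<alpha> = 1} = range (\<lambda>i. Poly_Mapping.single i 1)"
  proof (intro equalityI subsetI)
    fix \<alpha> :: "'v \<Rightarrow>\<^sub>0 nat" assume "\<alpha> \<in> {\<alpha>. mdeg \<alpha> = 1}"
    then have "(\<Sum>i\<in>UNIV. Poly_Mapping.lookup \<alpha> i) = 1" by (simp add: mdeg_def)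
    then obtain i where "Poly_Mapping.lookup \<alpha> i = 1" "\<And>j. j \<noteq> i \<Longrightarrow> Poly_Mapping.lookup \<alpha> j = 0"
      using sum_eq_Suc0_iff[of UNIV "Poly_Mapping.lookup \<alpha>"] by auto
    then have "\<alpha> = Poly_Mapping.single i 1"
      by (auto simp: poly_mapping_eq_iff fun_eq_iff lookup_single when_def)
    then show "\<alpha> \<in> range (\<lambda>i. Poly_Mapping.single i 1)" by blast
  qed auto
  moreover have "inj (\<lambda>i :: 'v. Poly_Mapping.single i (1 :: nat))"
    by (auto simp: inj_def poly_mapping_eq_iff fun_eq_iff lookup_single when_def split: if_splits)
  moreover have "monom_eval (Poly_Mapping.single i 1) w = w $ i" for i
    using cps_eval_var[of i w] by (simp add: cps_var_def)
  ultimately show ?thesis by (simp add: cps_eval_hom_part sum.reindex)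
qed

text \<open>For \<open>k \<ge> 2\<close> the power \<open>\<zeta>\<^sup>k\<close> takes the closed upper half plane onto the whole plane, so \<open>a * \<zeta>\<^sup>k\<close> also
  takes values in the lower half plane.\<close>

lemma leading_power_nonneg_on_upper_halfplane:
  assumes k: "k \<ge> 1" and a: "a \<noteq> 0" and nonneg: "\<And>\<zeta>. Im \<zeta> \<ge> 0 \<Longrightarrow> Im (a * \<zeta> ^ k) \<ge> 0"
  shows "k = 1" "Re a \<ge> 0"
proof -
  show "k = 1"
  proof (rule ccontr)
    assume "k \<noteq> 1"
    then have k2: "real k \<ge> 2" using k by linarith
    \<comment> \<open>\<open>cis \<theta>\<close> is the \<open>k\<close>-th power of \<open>cis (\<theta> / k)\<close>, and \<open>\<theta> / k \<le> pi\<close> as \<open>k \<ge> 2\<close>\<close>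
    have rot: "Im (a * cis \<theta>) \<ge> 0" if "0 \<le> \<theta>" "\<theta> \<le> 2 * pi" for \<theta>
    proof -
      have "\<theta> / k \<le> 2 * pi / 2" using that k2 by (intro frac_le) auto
      then have "Im (cis (\<theta> / k)) \<ge> 0" using that k by (auto intro!: sin_ge_zero)
      moreover have "cis (\<theta> / k) ^ k = cis \<theta>" using k2 by (simp add: Complex.DeMoivre)
      ultimately show ?thesis using nonneg by metis
    qed
    have "sin (3 / 2 * pi) = - 1" "cos (3 / 2 * pi) = 0"
      using sin_periodic_pi[of "pi / 2"] cos_periodic_pi[of "pi / 2"] by (simp_all add: field_simps)
    then have "Im a \<ge> 0" "Im a \<le> 0" "Re a \<ge> 0" "Re a \<le> 0"
      using rot[of 0] rot[of pi] rot[of "pi / 2"] rot[of "3 / 2 * pi"] by simp_all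
    then show False using a by (simp add: complex_eq_iff)
  qed
  then show "Re a \<ge> 0" using nonneg[of \<i>] by simp
qed

text \<open>On the \<open>i\<close>-th axis \<open>\<phi>\<close> is a series in one variable. It is nonzero because positive definiteness makes
  \<open>Im \<phi>\<^sub>N\<close> nonzero there. Its leading term \<open>a \<zeta>\<^sup>k\<close> maps the upper half plane to its closure, whence
  \<open>k = 1\<close>, and \<open>a\<close> is the coefficient of \<open>x\<^sub>i\<close> in \<open>\<phi>\<close>.\<close>

lemma linear_coeffs_positive:
  fixes \<phi> :: "('n::finite, complex) cps"
  assumes nonneg: "\<forall>\<^sub>F x in nhds 0. (\<forall>i. Im (x $ i) \<ge> 0) \<longrightarrow> Im (cps_eval \<phi> x) \<ge> 0"
    and \<phi>_0: "cps_coeff \<phi> 0 = 0"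
    and lower: "cps_Im (cps_hom_part 1 \<phi>) = 0"
    and pd: "pos_definite (cps_Im (cps_hom_part N \<phi>))"
  shows "Im (cps_coeff \<phi> (Poly_Mapping.single i 1)) = 0" "Re (cps_coeff \<phi> (Poly_Mapping.single i 1)) > 0"
proof -
  define e where "e = (axis i 1 :: complex ^ 'n)"
  let ?A = "\<lambda>k. cps_eval (cps_hom_part k \<phi>) e"
  have "e = vec_of_real (axis i 1)" by (simp add: e_def vec_eq_iff axis_def)
  then have "Im (?A N) > 0"
    using pd by (simp add: Im_cps_eval_vec_of_real[OF cps_summable_at_hom_part] pos_definite_def)
  then have "?A N \<noteq> 0" by auto
  define k where "k = (LEAST k. ?A k \<noteq> 0)"
  have k: "?A k \<noteq> 0"
    using \<open>?A N \<noteq> 0\<close> unfolding k_def by (rule LeastI)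
  have below_k: "?A j = 0" if "j < k" for j
    using not_less_Least[of j "\<lambda>k. ?A k \<noteq> 0"] that unfolding k_def by blast
  have "?A 0 = 0" using \<phi>_0 by (simp add: cps_eval_hom_part)
  with k have "k \<ge> 1" by (cases k) auto
  have "Im (?A k * \<zeta> ^ k) \<ge> 0" if \<zeta>: "Im \<zeta> \<ge> 0" for \<zeta>
  proof (rule tendsto_lowerbound)
    have "((\<lambda>t. cps_eval \<phi> (t *\<^sub>R (\<zeta> *s e)) / of_real t ^ k) \<longlongrightarrow> cps_eval (cps_hom_part k \<phi>) (\<zeta> *s e)) (at 0)"
      by (rule cps_leading_term_on_line) (simp add: cps_eval_hom_part_scale below_k)
    then have "((\<lambda>t. cps_eval \<phi> (t *\<^sub>R (\<zeta> *s e)) / of_real t ^ k) \<longlongrightarrow> ?A k * \<zeta> ^ k) (at_right 0)"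
      unfolding cps_eval_hom_part_scale mult.commute[of "\<zeta> ^ k"] by (rule tendsto_within_subset) simp
    then show "((\<lambda>t. Im (cps_eval \<phi> (t *\<^sub>R (\<zeta> *s e)) / of_real t ^ k)) \<longlongrightarrow> Im (?A k * \<zeta> ^ k)) (at_right 0)"
      by (rule tendsto_Im)
    have "filterlim (\<lambda>t. t *\<^sub>R (\<zeta> *s e)) (nhds 0) (at_right 0)"
      by (auto intro!: tendsto_eq_intros)
    from filterlim_iff[THEN iffD1, OF this, rule_format, OF nonneg] eventually_at_right_less[of 0]
    show "\<forall>\<^sub>F t in at_right 0. 0 \<le> Im (cps_eval \<phi> (t *\<^sub>R (\<zeta> *s e)) / of_real t ^ k)"
    proof eventually_elim
      case (elim t)
      have "Im ((t *\<^sub>R (\<zeta> *s e)) $ j) \<ge> 0" for j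
        using elim(2) \<zeta> by (auto simp: e_def axis_def)
      then have "Im (cps_eval \<phi> (t *\<^sub>R (\<zeta> *s e))) \<ge> 0" using elim(1) by blast
      then show ?case using elim(2) by (simp flip: of_real_power)
    qed
  qed simp
  from leading_power_nonneg_on_upper_halfplane[OF \<open>k \<ge> 1\<close> k this]
  have "k = 1" "Re (?A 1) \<ge> 0" by auto
  have A1: "?A 1 = cps_coeff \<phi> (Poly_Mapping.single i 1)"
    unfolding cps_eval_hom_part_1 by (simp add: e_def axis_def if_distrib cong: if_cong)
  show Im: "Im (cps_coeff \<phi> (Poly_Mapping.single i 1)) = 0"
    using arg_cong[OF lower, of "\<lambda>f. cps_coeff f (Poly_Mapping.single i 1)"] by simp
  have "?A 1 \<noteq> 0" using k \<open>k = 1\<close> by simp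
  then show "Re (cps_coeff \<phi> (Poly_Mapping.single i 1)) > 0"
    using \<open>Re (?A 1) \<ge> 0\<close> Im unfolding A1 by (auto simp: complex_eq_iff less_le)
qed

section \<open>The lower bound for the imaginary part\<close>

text \<open>The constant is the minimum over the unit sphere; homogeneity carries the bound to all of space.\<close>

lemma pos_definite_lower_bound:
  fixes f :: "('n::finite, real) cps"
  assumes "pos_definite (cps_hom_part N f)"
  shows "\<exists>c>0. \<forall>x. c * norm x ^ N \<le> cps_eval (cps_hom_part N f) x"
proof -
  let ?G = "cps_eval (cps_hom_part N f)"
  have "continuous_on (sphere 0 1) ?G"
    unfolding cps_eval_hom_part monom_eval_def by (intro continuous_intros)
  moreover have "axis undefined 1 \<in> sphere (0 :: real ^ 'n) 1" by simp
  ultimately obtain y where y: "y \<in> sphere 0 1" "\<And>x. x \<in> sphere 0 1 \<Longrightarrow> ?G y \<le> ?G x"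
    using continuous_attains_inf[of "sphere (0 :: real ^ 'n) 1" ?G] by (auto simp del: mem_sphere)
  have "?G y * norm x ^ N \<le> ?G x" for x
  proof (cases "x = 0")
    case True
    show ?thesis
    proof (cases "N = 0")
      case True
      have "?G x = ?G y"
        unfolding cps_eval_hom_part using True by (intro sum.cong) (auto simp: monom_eval_def)
      then show ?thesis using True by simp
    next
      case False
      have "?G (0 *s x) = 0 ^ N * ?G x" by (rule cps_eval_hom_part_scale)
      then show ?thesis using True False by (simp add: power_0_left)
    qed
  next
    case False
    have "x = norm x *s ((1 / norm x) *s x)" using False by (simp add: vec_eq_iff)
    then have "?G x = norm x ^ N * ?G ((1 / norm x) *s x)"
      using cps_eval_hom_part_scale by metis
    moreover have "(1 / norm x) *s x \<in> sphere 0 1"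
    proof -
      have "(1 / norm x) *s x = (1 / norm x) *\<^sub>R x" by (simp add: vec_eq_iff)
      then show ?thesis using False by simp
    qed
    ultimately show ?thesis using y(2) by (simp add: mult.commute mult_left_mono)
  qed
  moreover have "?G y > 0" using y(1) assms by (simp add: pos_definite_def)
  ultimately show ?thesis by blast
qed

lemma power_add_le_two_power:
  fixes s t :: real
  assumes "0 \<le> s" "0 \<le> t"
  shows "(s + t) ^ N \<le> 2 ^ N * (s ^ N + t ^ N)"
proof -
  have "(s + t) ^ N \<le> (2 * max s t) ^ N"
    using assms by (intro power_mono) auto
  also have "\<dots> \<le> 2 ^ N * (s ^ N + t ^ N)"
    using assms by (auto simp: power_mult_distrib max_def)
  finally show ?thesis .
qed

lemma Im_lower_bound_on_reals:
  fixes \<phi> :: "('n::finite, complex) cps"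
  assumes lower: "\<And>j. j < N \<Longrightarrow> cps_Im (cps_hom_part j \<phi>) = 0"
    and pd: "pos_definite (cps_Im (cps_hom_part N \<phi>))"
  shows "\<exists>c>0. \<forall>\<^sub>F a in nhds 0. c * norm a ^ N \<le> Im (cps_eval \<phi> (vec_of_real a))"
proof -
  let ?g = "cps_Im \<phi>" and ?G = "cps_hom_part N (cps_Im \<phi>)"
  obtain c where c: "c > 0" "\<And>x. c * norm x ^ N \<le> cps_eval ?G x"
    using pos_definite_lower_bound[of N ?g] pd by (auto simp: cps_hom_part_Im)
  have "cps_coeff (?g - ?G) \<alpha> = 0" if "mdeg \<alpha> < Suc N" for \<alpha>
    using that arg_cong[OF lower[of "mdeg \<alpha>"], of "\<lambda>f. cps_coeff f \<alpha>"] by (auto simp: less_Suc_eq)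
  then obtain C where C: "\<forall>\<^sub>F a in nhds 0. norm (cps_eval (?g - ?G) a) \<le> C * norm a ^ Suc N"
    using cps_order_bound[of "Suc N" "?g - ?G"] by blast
  have "((\<lambda>a :: real ^ 'n. C * norm a) \<longlongrightarrow> 0) (nhds 0)"
    by (auto intro!: tendsto_eq_intros filterlim_ident)
  then have small: "\<forall>\<^sub>F a :: real ^ 'n in nhds 0. C * norm a < c / 2"
    using c(1) by (intro order_tendstoD) auto
  have "\<forall>\<^sub>F a in nhds 0. c / 2 * norm a ^ N \<le> Im (cps_eval \<phi> (vec_of_real a))"
    using C small eventually_cps_eval_diff[of ?g ?G] eventually_Im_cps_eval_vec_of_real[of \<phi>]
  proof eventually_elim
    case (elim a)
    have "C * norm a ^ Suc N \<le> c / 2 * norm a ^ N"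
      using elim(2) mult_right_mono[of "C * norm a" "c / 2" "norm a ^ N"] by (simp add: mult_ac)
    then have "cps_eval ?g a \<ge> cps_eval ?G a - c / 2 * norm a ^ N"
      using elim(1,3) by simp
    then show ?case using c(2)[of a] elim(4) by simp
  qed
  then show ?thesis using c(1) half_gt_zero by blast
qed

text \<open>With \<open>x = a + ib\<close> and \<open>B = b\<^sub>1 + \<dots> + b\<^sub>d\<close>: the linear part of \<open>\<phi>\<close> contributes at least \<open>m B\<close> to
  \<open>Im \<phi>(x) - Im \<phi>(a)\<close>, where \<open>m\<close> is its least coefficient, and on a small polydisc the nonlinear part
  changes this by at most \<open>m B / 2\<close>. Together with \<open>Im \<phi>(a) \<ge> c |a|\<^sup>N\<close> this bounds \<open>|x|\<^sup>N\<close>, because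
  \<open>|x| \<le> |a| + B\<close> and \<open>B\<^sup>N \<le> B\<close>.\<close>

lemma Im_lower_bound_on_halfplane:
  fixes \<phi> :: "('n::finite, complex) cps"
  assumes nonneg: "\<forall>\<^sub>F x in nhds 0. (\<forall>i. Im (x $ i) \<ge> 0) \<longrightarrow> Im (cps_eval \<phi> x) \<ge> 0"
    and \<phi>_0: "cps_coeff \<phi> 0 = 0" and N: "N \<ge> 2"
    and lower: "\<And>j. j < N \<Longrightarrow> cps_Im (cps_hom_part j \<phi>) = 0"
    and pd: "pos_definite (cps_Im (cps_hom_part N \<phi>))"
  shows "\<exists>\<kappa>>0. \<forall>\<^sub>F x in nhds 0. x \<in> poly_halfplane \<longrightarrow> \<kappa> * norm x ^ N \<le> Im (cps_eval \<phi> x)"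
proof -
  define l where "l i = cps_coeff \<phi> (Poly_Mapping.single i 1)" for i
  have l: "Im (l i) = 0" "Re (l i) > 0" for i
    using linear_coeffs_positive[OF nonneg \<phi>_0 _ pd, of i] lower[of 1] N by (auto simp: l_def)
  define m where "m = Min (range (\<lambda>i. Re (l i)))"
  have m: "m > 0" "\<And>i. m \<le> Re (l i)"
    using l(2) by (auto simp: m_def)
  obtain c where c: "c > 0" "\<forall>\<^sub>F a in nhds 0. c * norm a ^ N \<le> Im (cps_eval \<phi> (vec_of_real a))"
    using Im_lower_bound_on_reals[of N \<phi>] lower pd by blast
  let ?\<phi>1 = "cps_hom_part 1 \<phi>"
  let ?\<psi> = "\<phi> - ?\<phi>1"
  have "cps_coeff ?\<psi> \<alpha> = 0" if "0 < mdeg \<alpha>" "mdeg \<alpha> \<le> 1" for \<alpha>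
    using that by (cases "mdeg \<alpha> = 1") auto
  then obtain C r where Cr: "C \<ge> 0" "r > 0"
    "\<forall>\<rho> w v. 0 < \<rho> \<longrightarrow> \<rho> \<le> r \<longrightarrow> (\<forall>i. norm (w $ i) \<le> \<rho>) \<longrightarrow> (\<forall>i. norm (v $ i) \<le> \<rho>) \<longrightarrow>
      norm (cps_eval ?\<psi> w - cps_eval ?\<psi> v) \<le> C * \<rho> ^ 1 * (\<Sum>i\<in>UNIV. norm (w $ i - v $ i))"
    by (rule cps_Lipschitz[of 1 ?\<psi>])
  \<comment> \<open>on this polydisc the nonlinear part varies at most half as fast as the linear part grows\<close>
  define \<rho> where "\<rho> = min r (m / 2 / (C + 1))"
  have \<rho>: "\<rho> > 0" "\<rho> \<le> r" "C * \<rho> \<le> m / 2"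
  proof -
    show "\<rho> > 0" "\<rho> \<le> r" using Cr m(1) by (auto simp: \<rho>_def)
    have "C * \<rho> \<le> (C + 1) * (m / 2 / (C + 1))"
      using Cr m(1) \<open>\<rho> > 0\<close> by (intro mult_mono) (auto simp: \<rho>_def)
    also have "\<dots> = m / 2"
      unfolding times_divide_eq_right[of "C + 1" "m / 2" "C + 1"]
      using Cr(1) by (intro nonzero_mult_div_cancel_left) linarith
    finally show "C * \<rho> \<le> m / 2" .
  qed
  define A where "A x = (\<chi> i. Re (x $ i))" for x :: "complex ^ 'n"
  define B where "B x = (\<Sum>i\<in>UNIV. Im (x $ i))" for x :: "complex ^ 'n"
  have coord: "((\<lambda>x :: complex ^ 'n. x $ i) \<longlongrightarrow> 0) (nhds 0)" for i
    using tendsto_vec_nth[OF filterlim_ident, where a = "0 :: complex ^ 'n"] by simp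
  have limA: "filterlim A (nhds 0) (nhds 0)"
    unfolding A_def using tendsto_Re[OF coord] by (intro vec_tendstoI) simp
  have "filterlim B (nhds 0) (nhds 0)"
    unfolding B_def
    using tendsto_sum[of UNIV "\<lambda>i (x :: complex ^ 'n). Im (x $ i)" "\<lambda>_. 0" "nhds 0"]
      tendsto_Im[OF coord] by simp
  then have small: "\<forall>\<^sub>F x in nhds 0. B x < 1"
    by (intro order_tendstoD) auto
  have evA: "\<forall>\<^sub>F x in nhds 0. P (A x)" if "\<forall>\<^sub>F a in nhds 0. P a" for P
    using limA that by (auto simp: filterlim_iff)
  have split: "\<forall>\<^sub>F x in nhds 0. cps_eval \<phi> x = cps_eval ?\<psi> x + cps_eval ?\<phi>1 x"
    using eventually_cps_eval_diff[of \<phi> ?\<phi>1] by eventually_elim simp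
  have disc: "\<forall>\<^sub>F x :: complex ^ 'n in nhds 0. \<forall>i. norm (x $ i) < \<rho>"
    using \<rho>(1) by (auto simp: eventually_nhds_0_iff_polydisc polydisc_def)
  define \<kappa> where "\<kappa> = min c (m / 2) / 2 ^ N"
  have "\<forall>\<^sub>F x in nhds 0. x \<in> poly_halfplane \<longrightarrow> \<kappa> * norm x ^ N \<le> Im (cps_eval \<phi> x)"
    using evA[OF c(2)] split evA[OF eventually_vec_of_real[OF split]] disc small
  proof eventually_elim
    case (elim x)
    show ?case
    proof
      assume "x \<in> poly_halfplane"
      then have pos: "Im (x $ i) > 0" for i by (simp add: poly_halfplane_def)
      define a where "a = (vec_of_real (A x) :: complex ^ 'n)"
      have x_a: "x $ i - a $ i = \<i> * Im (x $ i)" for i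
        by (simp add: a_def A_def complex_eq_iff)
      have norm_x_a: "norm (x $ i - a $ i) = Im (x $ i)" for i
        using pos[of i] unfolding x_a by (simp add: norm_mult)
      have B0: "B x \<ge> 0" unfolding B_def using pos by (intro sum_nonneg) (auto intro: less_imp_le)
      have "norm (a $ i) \<le> norm (x $ i)" for i
        by (simp add: a_def A_def abs_Re_le_cmod)
      then have "norm (a $ i) \<le> \<rho>" for i
        using elim(4) by (meson order_trans less_imp_le)
      then have "norm (cps_eval ?\<psi> x - cps_eval ?\<psi> a) \<le> C * \<rho> * B x"
        using Cr(3)[rule_format, of \<rho> x a] \<rho> elim(4) by (simp add: norm_x_a B_def less_imp_le)
      also have "\<dots> \<le> m / 2 * B x" using \<rho>(3) B0 by (rule mult_right_mono)
      finally have \<psi>: "- (m / 2 * B x) \<le> Im (cps_eval ?\<psi> x) - Im (cps_eval ?\<psi> a)"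
        using abs_Im_le_cmod[of "cps_eval ?\<psi> x - cps_eval ?\<psi> a"] by simp
      have "m * B x \<le> (\<Sum>i\<in>UNIV. Re (l i) * Im (x $ i))"
        unfolding B_def sum_distrib_left using m(2) pos by (intro sum_mono mult_right_mono) (auto intro: less_imp_le)
      also have "\<dots> = Im (cps_eval ?\<phi>1 x - cps_eval ?\<phi>1 a)"
        unfolding cps_eval_hom_part_1 l_def[symmetric] sum_subtractf[symmetric]
          right_diff_distrib[symmetric] x_a
        by (simp add: l(1))
      finally have "Im (cps_eval \<phi> x) \<ge> Im (cps_eval \<phi> a) + m / 2 * B x"
        using elim(2) elim(3)[folded a_def] \<psi> by simp
      then have main: "Im (cps_eval \<phi> x) \<ge> c * norm (A x) ^ N + m / 2 * B x"
        using elim(1) by (simp add: a_def)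
      have "norm x \<le> norm a + norm (x - a)" by (rule norm_triangle_sub)
      also have "norm (x - a) \<le> (\<Sum>i\<in>UNIV. norm ((x - a) $ i))"
        by (simp add: norm_vec_def L2_set_le_sum)
      also have "\<dots> = B x" by (simp add: norm_x_a B_def)
      finally have "norm x ^ N \<le> (norm (A x) + B x) ^ N"
        by (intro power_mono) (simp_all add: a_def norm_vec_of_real)
      also have "\<dots> \<le> 2 ^ N * (norm (A x) ^ N + B x ^ N)"
        using B0 by (intro power_add_le_two_power) auto
      also have "B x ^ N \<le> B x ^ 1"
        using B0 elim(5) N by (intro power_decreasing) auto
      finally have "\<kappa> * norm x ^ N \<le> \<kappa> * (2 ^ N * (norm (A x) ^ N + B x))"
        using c(1) m(1) by (intro mult_left_mono) (auto simp: \<kappa>_def)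
      also have "\<dots> = min c (m / 2) * norm (A x) ^ N + min c (m / 2) * B x"
        by (simp add: \<kappa>_def distrib_left)
      also have "\<dots> \<le> c * norm (A x) ^ N + m / 2 * B x"
        using B0 by (intro add_mono mult_right_mono) auto
      finally show "\<kappa> * norm x ^ N \<le> Im (cps_eval \<phi> x)" using main by simp
    qed
  qed
  moreover have "\<kappa> > 0" using c(1) m(1) by (simp add: \<kappa>_def)
  ultimately show ?thesis by blast
qed

section \<open>The ideal of admissible numerators\<close>

lemma not_real_imp_Im_hom_part:
  assumes "\<phi> \<notin> range cps_of_real"
  shows "\<exists>j. cps_Im (cps_hom_part j \<phi>) \<noteq> 0"
proof (rule ccontr)
  assume "\<not> ?thesis"
  then have *: "cps_coeff (cps_Im (cps_hom_part (mdeg \<alpha>) \<phi>)) \<alpha> = 0" for \<alpha> by simp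
  define \<psi> where "\<psi> = Abs_cps (\<lambda>\<alpha>. Re (cps_coeff \<phi> \<alpha>))"
  have "convergent_coeffs (\<lambda>\<alpha>. Re (cps_coeff \<phi> \<alpha>))"
    by (rule convergent_coeffs_mono[of "cps_coeff \<phi>"]) (use cps_coeff abs_Re_le_cmod in auto)
  then have "\<phi> = cps_of_real \<psi>"
    using * by (intro cps_eqI) (simp add: \<psi>_def cps_of_real.rep_eq Abs_cps_inverse complex_eq_iff)
  then show False using assms by blast
qed

text \<open>Since \<open>u\<close> is bounded away from \<open>0\<close>, \<open>|z + \<phi>|\<close> is controlled by \<open>|p|\<close>, and
  \<open>\<kappa> |x|\<^sup>N \<le> Im \<phi>(x) \<le> Im (z + \<phi>(x)) \<le> |z + \<phi>(x)|\<close>.\<close>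

lemma graph_ideal_le_admissible_numerators:
  fixes \<phi> :: "('n::finite, complex) cps"
  assumes no_zeros: "\<forall>w \<in> poly_halfplane. mpoly_eval p w \<noteq> 0"
    and fact: "\<forall>\<^sub>F w in nhds 0. mpoly_eval p w = cps_eval u w * (w $ None + cps_eval \<phi> (x_part w))"
    and u_0: "cps_eval u 0 \<noteq> 0"
    and \<kappa>: "\<kappa> > 0" "\<forall>\<^sub>F x in nhds 0. x \<in> poly_halfplane \<longrightarrow> \<kappa> * norm x ^ N \<le> Im (cps_eval \<phi> x)"
    and diff: "\<And>\<alpha>. mdeg \<alpha> < N \<Longrightarrow> cps_coeff (\<phi> - q) \<alpha> = 0"
  shows "graph_ideal N q \<subseteq> admissible_numerators p"
proof -
  \<comment> \<open>\<open>|u| > \<delta>\<close> near the origin\<close>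
  define \<delta> where "\<delta> = norm (cps_eval u 0) / 2"
  have \<delta>: "\<delta> > 0" using u_0 by (simp add: \<delta>_def)
  have u: "\<forall>\<^sub>F w in nhds 0. norm (cps_eval u w) > \<delta>"
    using tendsto_norm[OF tendsto_cps_eval_nhds_0[of u]] u_0
    by (intro order_tendstoD) (auto simp: \<delta>_def)
  have below: "\<forall>\<^sub>F w in nhds 0. w \<in> poly_halfplane \<longrightarrow>
      \<delta> * norm (w $ None + cps_eval \<phi> (x_part w)) \<le> norm (mpoly_eval p w) \<and>
      \<kappa> * norm (x_part w) ^ N \<le> norm (w $ None + cps_eval \<phi> (x_part w))"
    using fact u eventually_x_part[OF \<kappa>(2)]
  proof eventually_elim
    case (elim w)
    show ?case
    proof (intro impI conjI)
      assume w: "w \<in> poly_halfplane"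
      show "\<delta> * norm (w $ None + cps_eval \<phi> (x_part w)) \<le> norm (mpoly_eval p w)"
        using elim(1,2) by (simp add: norm_mult mult_right_mono)
      have "x_part w \<in> poly_halfplane" "Im (w $ None) > 0"
        using w by (auto simp: poly_halfplane_def)
      then have "\<kappa> * norm (x_part w) ^ N \<le> Im (w $ None + cps_eval \<phi> (x_part w))"
        using elim(3) by simp
      then show "\<kappa> * norm (x_part w) ^ N \<le> norm (w $ None + cps_eval \<phi> (x_part w))"
        using abs_Im_le_cmod[of "w $ None + cps_eval \<phi> (x_part w)"] by linarith
    qed
  qed
  have monom: "cps_incl (cps_monom \<alpha>) \<in> admissible_numerators p" if "mdeg \<alpha> = N" for \<alpha>
    unfolding admissible_numerators_iff[OF no_zeros]
  proof (intro exI)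
    show "\<forall>\<^sub>F w in nhds 0. w \<in> poly_halfplane \<longrightarrow>
        norm (cps_eval (cps_incl (cps_monom \<alpha>)) w) \<le> 1 / (\<kappa> * \<delta>) * norm (mpoly_eval p w)"
      using below
    proof eventually_elim
      case (elim w)
      show ?case
      proof
        assume w: "w \<in> poly_halfplane"
        let ?v = "w $ None + cps_eval \<phi> (x_part w)"
        have "norm (monom_eval \<alpha> (x_part w)) \<le> norm (x_part w) ^ N"
          using norm_monom_eval_le[of "x_part w" "norm (x_part w)" \<alpha>] that
            Finite_Cartesian_Product.norm_nth_le[of "x_part w"] by (simp del: x_part_nth)
        then have "\<kappa> * norm (monom_eval \<alpha> (x_part w)) \<le> norm ?v"
          using elim w \<kappa>(1) by (meson mult_left_mono order_trans less_imp_le)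
        then have "\<delta> * (\<kappa> * norm (monom_eval \<alpha> (x_part w))) \<le> norm (mpoly_eval p w)"
          using elim w \<delta> by (meson mult_left_mono order_trans less_imp_le)
        then show "norm (cps_eval (cps_incl (cps_monom \<alpha>)) w) \<le> 1 / (\<kappa> * \<delta>) * norm (mpoly_eval p w)"
          using \<delta> \<kappa>(1) by (simp add: field_simps)
      qed
    qed
  qed
  obtain D where D: "\<forall>\<^sub>F x in nhds 0. norm (cps_eval (\<phi> - q) x) \<le> D * norm x ^ N"
    using cps_order_bound[of N "\<phi> - q"] diff by blast
  have "cps_var None + cps_incl q \<in> admissible_numerators p"
    unfolding admissible_numerators_iff[OF no_zeros]
  proof (intro exI)
    show "\<forall>\<^sub>F w in nhds 0. w \<in> poly_halfplane \<longrightarrow>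
        norm (cps_eval (cps_var None + cps_incl q) w) \<le> (1 + \<bar>D\<bar> / \<kappa>) / \<delta> * norm (mpoly_eval p w)"
      using below eventually_x_part[OF D] eventually_x_part[OF eventually_cps_eval_diff[of \<phi> q]]
        eventually_cps_eval_add[of "cps_var None" "cps_incl q"]
    proof eventually_elim
      case (elim w)
      show ?case
      proof
        assume w: "w \<in> poly_halfplane"
        let ?v = "w $ None + cps_eval \<phi> (x_part w)"
        have "cps_eval (cps_var None + cps_incl q) w = ?v - cps_eval (\<phi> - q) (x_part w)"
          using elim by simp
        also have "norm \<dots> \<le> norm ?v + D * norm (x_part w) ^ N"
          using elim norm_triangle_ineq4 by (meson add_left_mono order_trans)
        also have "D * norm (x_part w) ^ N \<le> \<bar>D\<bar> / \<kappa> * (\<kappa> * norm (x_part w) ^ N)"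
          using \<kappa>(1) by (simp add: mult_right_mono)
        also have "\<dots> \<le> \<bar>D\<bar> / \<kappa> * norm ?v"
          using elim w \<kappa>(1) by (intro mult_left_mono) auto
        finally have "norm (cps_eval (cps_var None + cps_incl q) w) \<le> (1 + \<bar>D\<bar> / \<kappa>) * norm ?v"
          by (simp add: distrib_right)
        also have "\<dots> \<le> (1 + \<bar>D\<bar> / \<kappa>) * (norm (mpoly_eval p w) / \<delta>)"
          using elim w \<delta> \<kappa>(1) by (intro mult_left_mono) (auto simp: field_simps)
        finally show "norm (cps_eval (cps_var None + cps_incl q) w)
            \<le> (1 + \<bar>D\<bar> / \<kappa>) / \<delta> * norm (mpoly_eval p w)" by simp
      qed
    qed
  qed
  with monom have "insert (cps_var None + cps_incl q) {cps_incl (cps_monom \<alpha>) | \<alpha>. mdeg \<alpha> = N}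
      \<subseteq> admissible_numerators p" by blast
  then show ?thesis
    unfolding graph_ideal_def ideal_generated_by_def
    by (rule module.span_minimal[OF module_self _ admissible_numerators_subspace[OF no_zeros]])
qed

text \<open>The bound \<open>|h(x)| \<le> C |p(x, z)|\<close> extends by continuity to real \<open>x\<close> and \<open>z\<close>. The best choice is
  \<open>z = -q(x)\<close>, which is real because \<open>q\<close> has real coefficients; there \<open>p = u (\<phi> - q)\<close> is \<open>O(|x|\<^sup>N)\<close>.\<close>

lemma admissible_x_series_high_order:
  fixes \<phi> :: "('n::finite, complex) cps"
  assumes no_zeros: "\<forall>w \<in> poly_halfplane. mpoly_eval p w \<noteq> 0"
    and fact: "\<forall>\<^sub>F w in nhds 0. mpoly_eval p w = cps_eval u w * (w $ None + cps_eval \<phi> (x_part w))"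
    and diff: "\<And>\<alpha>. mdeg \<alpha> < N \<Longrightarrow> cps_coeff (\<phi> - q) \<alpha> = 0"
    and q_0: "cps_coeff q 0 = 0" and q_real: "cps_Im q = 0"
    and h: "cps_incl h \<in> admissible_numerators p" and "mdeg \<alpha> < N"
  shows "cps_coeff h \<alpha> = 0"
proof -
  obtain C where C: "\<forall>\<^sub>F w in nhds 0. w \<in> poly_halfplane \<longrightarrow>
      norm (cps_eval (cps_incl h) w) \<le> C * norm (mpoly_eval p w)"
    using h by (auto simp: admissible_numerators_iff[OF no_zeros])
  let ?F = "\<lambda>w. \<bar>C\<bar> * norm (mpoly_eval p w) - norm (cps_eval (cps_incl h) w)"
  have "\<forall>\<^sub>F w in nhds 0. isCont ?F w"
    using eventually_cps_eval_isCont[of "cps_of_mpoly p"] eventually_cps_eval_isCont[of "cps_incl h"]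
    by eventually_elim (auto simp: isCont_def cps_eval_of_mpoly[abs_def] simp del: cps_eval_incl intro!: tendsto_intros)
  moreover have "\<forall>\<^sub>F w in nhds 0. w \<in> poly_halfplane \<longrightarrow> ?F w \<ge> 0"
    using C
  proof eventually_elim
    case (elim w)
    have "C * norm (mpoly_eval p w) \<le> \<bar>C\<bar> * norm (mpoly_eval p w)" by (simp add: mult_right_mono)
    then show ?case using elim by auto
  qed
  ultimately have closed: "\<forall>\<^sub>F w in nhds 0. (\<forall>i. Im (w $ i) \<ge> 0) \<longrightarrow> ?F w \<ge> 0"
    by (rule eventually_nonneg_on_closed_halfplane)
  \<comment> \<open>the real points of the truncated graph, which approach the origin\<close>
  define s where "s x = with_z (vec_of_real x) (- cps_eval q (vec_of_real x))" for x :: "real ^ 'n"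
  have "((\<lambda>x. - cps_eval q (vec_of_real x)) \<longlongrightarrow> 0) (nhds 0)"
    using tendsto_minus[OF filterlim_compose[OF tendsto_cps_eval_nhds_0[of q] tendsto_vec_of_real]] q_0
    by (simp add: cps_eval_0)
  then have "filterlim s (nhds 0) (nhds 0)"
    unfolding s_def by (intro tendsto_with_z tendsto_vec_of_real)
  then have evs: "\<forall>\<^sub>F x in nhds 0. P (s x)" if "\<forall>\<^sub>F w in nhds 0. P w" for P
    using that by (auto simp: filterlim_iff)
  obtain D where D: "\<forall>\<^sub>F x in nhds 0. norm (cps_eval (\<phi> - q) x) \<le> D * norm x ^ N"
    using cps_order_bound[of N "\<phi> - q"] diff by blast
  obtain U where U: "\<forall>\<^sub>F w in nhds 0. norm (cps_eval u w) \<le> U * norm w ^ 0"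
    using cps_order_bound[of 0 u] by blast
  have "\<forall>\<^sub>F x in nhds (0 :: real ^ 'n). norm (cps_eval h (vec_of_real x)) \<le> (\<bar>C\<bar> * (\<bar>U\<bar> * D)) * norm x ^ N"
    using evs[OF closed] evs[OF fact] evs[OF U] eventually_vec_of_real[OF D]
      eventually_vec_of_real[OF eventually_cps_eval_diff[of \<phi> q]]
      eventually_Im_cps_eval_vec_of_real[of q]
  proof eventually_elim
    case (elim x)
    have "Im (s x $ i) \<ge> 0" for i
      using elim(6) q_real by (cases i) (simp_all add: s_def with_z_def cps_eval_def)
    then have "norm (cps_eval h (vec_of_real x)) \<le> \<bar>C\<bar> * norm (mpoly_eval p (s x))"
      using elim(1) by (simp add: s_def)
    also have "mpoly_eval p (s x) = cps_eval u (s x) * cps_eval (\<phi> - q) (vec_of_real x)"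
      using elim(2,5) by (simp add: s_def)
    also have "\<bar>C\<bar> * norm \<dots> \<le> \<bar>C\<bar> * (\<bar>U\<bar> * (D * norm x ^ N))"
      unfolding norm_mult using elim(3,4) by (intro mult_left_mono mult_mono) (auto simp: norm_vec_of_real)
    finally show ?case by (simp add: mult.assoc)
  qed
  then show ?thesis using \<open>mdeg \<alpha> < N\<close> by (rule cps_coeffs_zero_if_bound_on_reals)
qed

theorem theorem1p4:
  fixes p :: "('n::finite option \<Rightarrow>\<^sub>0 nat) \<Rightarrow>\<^sub>0 complex"
    and \<phi> :: "('n, complex) cps"
    and u :: "('n option, complex) cps"
    and N :: nat
  assumes no_zeros: "\<forall>w \<in> poly_halfplane. mpoly_eval p w \<noteq> 0"
    and p_0: "mpoly_eval p 0 = 0"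
    and dp_dz_0: "deriv (\<lambda>z. mpoly_eval p (with_z 0 z)) 0 \<noteq> 0"
    and factorization: "cps_of_mpoly p = u * (cps_var None + cps_incl \<phi>)"
    and \<phi>_0: "cps_eval \<phi> 0 = 0"
    and u_0: "cps_eval u 0 \<noteq> 0"
    and not_real: "\<phi> \<notin> range cps_of_real"
    and N: "N = (LEAST j. cps_Im (cps_hom_part j \<phi>) \<noteq> 0)"
  shows "\<exists>L\<ge>1. N = 2 * L \<and>
    (pos_definite (cps_Im (cps_hom_part (2 * L) \<phi>)) \<longrightarrow>
      admissible_numerators p =
        ideal_generated_by
          (insert (cps_var None + cps_incl (\<Sum>j<2 * L. cps_hom_part j \<phi>))
            {cps_incl (cps_monom \<alpha>) | \<alpha>. mdeg \<alpha> = 2 * L}))"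
proof -
  have coeff_0: "cps_coeff \<phi> 0 = 0" using \<phi>_0 by (simp add: cps_eval_0)
  have NIm: "cps_Im (cps_hom_part N \<phi>) \<noteq> 0"
    using not_real_imp_Im_hom_part[OF not_real] unfolding N by (rule LeastI_ex)
  have lower: "cps_Im (cps_hom_part j \<phi>) = 0" if "j < N" for j
    using not_less_Least[of j "\<lambda>j. cps_Im (cps_hom_part j \<phi>) \<noteq> 0"] that unfolding N by blast
  have fact: "\<forall>\<^sub>F w in nhds 0. mpoly_eval p w = cps_eval u w * (w $ None + cps_eval \<phi> (x_part w))"
    using eventually_cps_eval_times[of u "cps_var None + cps_incl \<phi>"]
      eventually_cps_eval_add[of "cps_var None" "cps_incl \<phi>"]
    by eventually_elim (simp flip: factorization)
  note nonneg = eventually_graph_in_lower_halfplane[OF no_zeros fact \<phi>_0]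
  have "even N" using first_nonreal_degree_even[OF nonneg lower NIm] .
  then obtain L where L: "N = 2 * L" by blast
  have "N \<noteq> 0"
  proof
    assume "N = 0"
    have "cps_Im (cps_hom_part 0 \<phi>) = 0" by (rule cps_eqI) (simp add: coeff_0)
    then show False using NIm \<open>N = 0\<close> by simp
  qed
  then have "L \<ge> 1" "N \<ge> 2" using L by auto
  define q where "q = (\<Sum>j<N. cps_hom_part j \<phi>)"
  have q: "cps_coeff q \<alpha> = (if mdeg \<alpha> < N then cps_coeff \<phi> \<alpha> else 0)" for \<alpha>
    by (simp add: q_def)
  have "admissible_numerators p = graph_ideal N q" if pd: "pos_definite (cps_Im (cps_hom_part N \<phi>))"
  proof
    have diff: "cps_coeff (\<phi> - q) \<alpha> = 0" if "mdeg \<alpha> < N" for \<alpha>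
      using that by (simp add: q)
    have q_0: "cps_coeff q 0 = 0" using coeff_0 by (simp add: q)
    have q_real: "cps_Im q = 0"
    proof (rule cps_eqI)
      fix \<alpha>
      have "Im (cps_coeff \<phi> \<alpha>) = 0" if "mdeg \<alpha> < N"
        using arg_cong[OF lower[OF that], of "\<lambda>f. cps_coeff f \<alpha>"] by simp
      then show "cps_coeff (cps_Im q) \<alpha> = cps_coeff 0 \<alpha>" by (simp add: q)
    qed
    obtain \<kappa> where \<kappa>: "\<kappa> > 0"
      "\<forall>\<^sub>F x in nhds 0. x \<in> poly_halfplane \<longrightarrow> \<kappa> * norm x ^ N \<le> Im (cps_eval \<phi> x)"
      using Im_lower_bound_on_halfplane[OF nonneg coeff_0 \<open>N \<ge> 2\<close> lower pd] by blast
    show le: "graph_ideal N q \<subseteq> admissible_numerators p"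
      by (rule graph_ideal_le_admissible_numerators[OF no_zeros fact u_0 \<kappa> diff])
    show "admissible_numerators p \<subseteq> graph_ideal N q"
    proof
      fix f assume f: "f \<in> admissible_numerators p"
      obtain h where h: "f - cps_incl h \<in> graph_ideal N q"
        using reduce_mod_graph_ideal[OF q_0] by blast
      have "f - (f - cps_incl h) \<in> admissible_numerators p"
        by (rule module.subspace_diff[OF module_self admissible_numerators_subspace[OF no_zeros] f subsetD[OF le h]])
      then have "cps_incl h \<in> admissible_numerators p" by simp
      then have "cps_incl h \<in> graph_ideal N q"
        by (intro cps_incl_in_graph_ideal admissible_x_series_high_order[OF no_zeros fact diff q_0 q_real])
      with h have "(f - cps_incl h) + cps_incl h \<in> graph_ideal N q"
        unfolding graph_ideal_def by (rule ideal_generated_by_add)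
      then show "f \<in> graph_ideal N q" by simp
    qed
  qed
  then show ?thesis
    using L \<open>L \<ge> 1\<close> unfolding graph_ideal_def q_def by blast
qed

end
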